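(* Let $G$ be a graph on $n$ vertices that has a subgraph $G'$ with $V(G') = V(G)$ such that every vertex of $G'$ has degree at most $3\cdot 10^5$ in $G'$, and fewer than $\frac{1}{60}\cdot n$ vertices of $G'$ have degree less than $14$ in $G'$. Then $G$ has at most $\mathcal{O}(2^{n(1-10^{-26})})$ minimal connected dominating sets. Further, there is an algorithm that, given as input $G$ and $G'$, enumerates all minimal connected dominating sets of $G$ in time $2^{n(1-10^{-26})}\cdot n^{\mathcal{O}(1)}$.
   Context: All graphs are finite and simple. A vertex subset $S$ of $G$ is a dominating set if every vertex not in $S$ has a neighbor in $S$; it is a connected dominating set if moreover $G[S]$ is connected; a connected dominating set is minimal if no proper subset of it is a connected dominating set. *)

theory Defs
  imports Complex_Main "Graph_Theory.Graph_Theory"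
begin

section \<open>Connected dominating sets\<close>

text \<open>
  A finite simple graph is a \<^locale>\<open>graph\<close> of the library: a finite, loop-free, symmetric digraph
  without parallel arcs.  Each undirected edge is a pair of opposite arcs, so the degree of a
  vertex is its \<^const>\<open>out_degree\<close>.  The library's \<open>connected\<close> is false for the graph without
  vertices.
\<close>

definition dominating_set :: "('a, 'b) pre_digraph \<Rightarrow> 'a set \<Rightarrow> bool" where
  "dominating_set G S \<longleftrightarrow>
     S \<subseteq> verts G \<and> (\<forall>v \<in> verts G - S. \<exists>u \<in> S. v \<rightarrow>\<^bsub>G\<^esub> u)"

definition connected_dominating_set :: "('a, 'b) pre_digraph \<Rightarrow> 'a set \<Rightarrow> bool" where
  "connected_dominating_set G S \<longleftrightarrow>
     dominating_set G S \<and> Digraph_Component.connected (G \<restriction> S)"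

definition minimal_cds :: "('a, 'b) pre_digraph \<Rightarrow> 'a set \<Rightarrow> bool" where
  "minimal_cds G S \<longleftrightarrow>
     connected_dominating_set G S \<and> (\<forall>T. T \<subset> S \<longrightarrow> \<not> connected_dominating_set G T)"

definition degree_conditions :: "('a, 'b) pre_digraph \<Rightarrow> bool" where
  "degree_conditions H \<longleftrightarrow>
     (\<forall>v \<in> verts H. out_degree H v \<le> 3 * 10 ^ 5) \<and>
     real (card {v \<in> verts H. out_degree H v < 14}) < 1 / 60 * real (card (verts H))"


section \<open>Algorithms and running time\<close>

text \<open>
  The model of computation is a first-order functional language over binary trees (pure LISP
  with the single atom \<open>NIL\<close>).  A program is a list of function bodies.  Variables are de Bruijn
  indices into the environment: in a function body they denote the arguments, and \<open>LET\<close> puts a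
  new value in front.  As \<open>NIL\<close> is the only atom and every primitive touches a bounded number of
  cons cells, each unit of time is a bounded number of steps of a pointer machine or RAM (by
  sharing cells), for a bound that depends only on the program.
\<close>

datatype sexp = NIL | CONS sexp sexp

fun car :: "sexp \<Rightarrow> sexp" where
  "car NIL = NIL"
| "car (CONS a b) = a"

fun cdr :: "sexp \<Rightarrow> sexp" where
  "cdr NIL = NIL"
| "cdr (CONS a b) = b"

datatype expr =
    VAR nat
  | NILE
  | CONSE expr expr
  | CAR expr
  | CDR expr
  | IF expr expr expr
  | LET expr expr
  | CALL nat "expr list"

type_synonym program = "expr list"

text \<open>
  \<open>evaluates P env e v t\<close>: under the program \<open>P\<close>, evaluation of \<open>e\<close> in the environment \<open>env\<close>
  terminates with value \<open>v\<close> after \<open>t\<close> steps.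
\<close>

inductive evaluates :: "program \<Rightarrow> sexp list \<Rightarrow> expr \<Rightarrow> sexp \<Rightarrow> nat \<Rightarrow> bool"
  and evaluates_args :: "program \<Rightarrow> sexp list \<Rightarrow> expr list \<Rightarrow> sexp list \<Rightarrow> nat \<Rightarrow> bool"
  for P :: program
where
  ev_var: "i < length env \<Longrightarrow> evaluates P env (VAR i) (env ! i) 1"
| ev_nil: "evaluates P env NILE NIL 1"
| ev_cons: "evaluates P env e1 v1 t1 \<Longrightarrow> evaluates P env e2 v2 t2 \<Longrightarrow>
    evaluates P env (CONSE e1 e2) (CONS v1 v2) (t1 + t2 + 1)"
| ev_car: "evaluates P env e v t \<Longrightarrow> evaluates P env (CAR e) (car v) (t + 1)"
| ev_cdr: "evaluates P env e v t \<Longrightarrow> evaluates P env (CDR e) (cdr v) (t + 1)"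
| ev_if_true: "evaluates P env b w t1 \<Longrightarrow> w \<noteq> NIL \<Longrightarrow> evaluates P env e1 v t2 \<Longrightarrow>
    evaluates P env (IF b e1 e2) v (t1 + t2 + 1)"
| ev_if_false: "evaluates P env b NIL t1 \<Longrightarrow> evaluates P env e2 v t2 \<Longrightarrow>
    evaluates P env (IF b e1 e2) v (t1 + t2 + 1)"
| ev_let: "evaluates P env e1 w t1 \<Longrightarrow> evaluates P (w # env) e2 v t2 \<Longrightarrow>
    evaluates P env (LET e1 e2) v (t1 + t2 + 1)"
| ev_call: "evaluates_args P env es ws t1 \<Longrightarrow> f < length P \<Longrightarrow> evaluates P ws (P ! f) v t2 \<Longrightarrow>
    evaluates P env (CALL f es) v (t1 + t2 + 1)"
| ev_args_Nil: "evaluates_args P env [] [] 0"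
| ev_args_Cons: "evaluates P env e v t1 \<Longrightarrow> evaluates_args P env es vs t2 \<Longrightarrow>
    evaluates_args P env (e # es) (v # vs) (t1 + t2)"

lemma evaluates_deterministic:
  "evaluates P env e v t \<Longrightarrow> evaluates P env e v' t' \<Longrightarrow> v' = v \<and> t' = t"
  "evaluates_args P env es vs t \<Longrightarrow> evaluates_args P env es vs' t' \<Longrightarrow> vs' = vs \<and> t' = t"
proof (induction arbitrary: v' t' and vs' t' rule: evaluates_evaluates_args.inducts)
  case (ev_var i env)
  from ev_var.prems show ?case by cases simp_all
next
  case (ev_nil env)
  from ev_nil.prems show ?case by cases simp_all
next
  case (ev_cons env e1 v1 t1 e2 v2 t2)
  from ev_cons.prems show ?case by cases (use ev_cons.IH in blast)
next
  case (ev_car env e v t)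
  from ev_car.prems show ?case by cases (use ev_car.IH in blast)
next
  case (ev_cdr env e v t)
  from ev_cdr.prems show ?case by cases (use ev_cdr.IH in blast)
next
  case (ev_if_true env b w t1 e1 v t2 e2)
  from ev_if_true.prems show ?case by cases (use ev_if_true.IH ev_if_true.hyps in blast)+
next
  case (ev_if_false env b t1 e2 v t2 e1)
  from ev_if_false.prems show ?case by cases (use ev_if_false.IH in blast)+
next
  case (ev_let env e1 w t1 e2 v t2)
  from ev_let.prems show ?case by cases (use ev_let.IH in blast)
next
  case (ev_call env es ws t1 f v t2)
  from ev_call.prems show ?case by cases (use ev_call.IH in blast)
next
  case (ev_args_Nil env)
  from ev_args_Nil.prems show ?case by cases simp_all
next
  case (ev_args_Cons env e v t1 es vs t2)
  from ev_args_Cons.prems show ?case by cases (use ev_args_Cons.IH in blast)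
qed

definition runs :: "program \<Rightarrow> sexp \<Rightarrow> sexp \<Rightarrow> nat \<Rightarrow> bool" where
  "runs P x y t \<longleftrightarrow> evaluates P [x] (CALL 0 [VAR 0]) y t"

primrec enc_nat :: "nat \<Rightarrow> sexp" where
  "enc_nat 0 = NIL"
| "enc_nat (Suc n) = CONS NIL (enc_nat n)"

definition enc_bool :: "bool \<Rightarrow> sexp" where
  "enc_bool b = (if b then CONS NIL NIL else NIL)"

primrec enc_list :: "('a \<Rightarrow> sexp) \<Rightarrow> 'a list \<Rightarrow> sexp" where
  "enc_list f [] = NIL"
| "enc_list f (x # xs) = CONS (f x) (enc_list f xs)"

text \<open>The adjacency matrix of a graph with vertex set \<open>{..<n}\<close>.\<close>

definition enc_graph :: "nat \<Rightarrow> (nat, 'b) pre_digraph \<Rightarrow> sexp" where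
  "enc_graph n G =
     enc_list (\<lambda>u. enc_list (\<lambda>v. enc_bool (u \<rightarrow>\<^bsub>G\<^esub> v)) [0..<n]) [0..<n]"

text \<open>\<open>y\<close> lists every member of the family \<open>F\<close> exactly once and nothing else.\<close>

definition lists_family :: "sexp \<Rightarrow> nat set set \<Rightarrow> bool" where
  "lists_family y F \<longleftrightarrow>
     (\<exists>xss. y = enc_list (enc_list enc_nat) xss \<and> (\<forall>xs \<in> set xss. distinct xs) \<and>
            distinct (map set xss) \<and> set (map set xss) = F)"

end

theory Submission
  imports Defs
begin

text \<open>
  Let \<open>S\<close> be a minimal connected dominating set and let \<open>A\<close> be the set of vertices with at most two
  \<open>G'\<close>-neighbours in \<open>S\<close>.  A vertex of \<open>S\<close> that is not a cut vertex of \<open>G[S]\<close> has a private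
  neighbour, which lies in \<open>A\<close>, so \<open>G[S]\<close> has at most \<open>|A|\<close> non-cut vertices.  A connected graph with
  few non-cut vertices has few vertices of degree at least 3, and the other vertices of \<open>S\<close> are
  in \<open>A\<close>; altogether \<open>|S| \<le> 5|A|\<close>.  For a uniformly random \<open>S\<close> the expectation of \<open>5|A| - |S|\<close> is at
  most \<open>-n/4\<close>, and by the degree bound this quantity changes by at most a constant when one vertex
  is added, so by a bounded differences inequality exponentially few sets satisfy \<open>|S| \<le> 5|A|\<close>.

  As \<open>A\<close> shrinks when \<open>S\<close> grows, this family is closed under subsets.  Deciding the vertices one after
  another and giving up as soon as the set chosen so far leaves the family therefore visits at most
  \<open>2n\<close> nodes per member of the family (and the root).  Minimality is tested by deleting single vertices,
  since a superset of a connected dominating set is again one.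
\<close>

section \<open>Connected graphs with few non-cut vertices\<close>

text \<open>Connectedness by cuts instead of paths: joining and splitting at a vertex then reduce to
  restricting or extending a cut. For symmetric \<open>E\<close> it is ordinary connectedness of the
  induced graph, with the empty set excluded as in the library.\<close>

definition conn :: "('a \<Rightarrow> 'a \<Rightarrow> bool) \<Rightarrow> 'a set \<Rightarrow> bool" where
  "conn E S \<longleftrightarrow> S \<noteq> {} \<and> (\<forall>A. A \<subseteq> S \<and> A \<noteq> {} \<and> A \<noteq> S \<longrightarrow> (\<exists>a\<in>A. \<exists>b\<in>S - A. E a b))"

definition deg :: "('a \<Rightarrow> 'a \<Rightarrow> bool) \<Rightarrow> 'a set \<Rightarrow> 'a \<Rightarrow> nat" where
  "deg E S x = card {y \<in> S. E x y}"

text \<open>A nontrivial cut of the union cannot be trivial on both \<open>X\<close> and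
  \<open>Y\<close>, since the side of the common vertex \<open>v\<close> would then decide it
  everywhere. So it is nontrivial on one of them, which supplies the crossing edge.\<close>

lemma conn_Un:
  assumes X: "conn E X" and Y: "conn E Y" and v: "v \<in> X" "v \<in> Y"
  shows "conn E (X \<union> Y)"
  unfolding conn_def
proof (intro conjI allI impI)
  show "X \<union> Y \<noteq> {}" using v by auto
  fix A assume A: "A \<subseteq> X \<union> Y \<and> A \<noteq> {} \<and> A \<noteq> X \<union> Y"
  consider "A \<inter> X \<noteq> {} \<and> A \<inter> X \<noteq> X" | "A \<inter> Y \<noteq> {} \<and> A \<inter> Y \<noteq> Y"
    using A v by blast
  then show "\<exists>a\<in>A. \<exists>b\<in>X \<union> Y - A. E a b"
  proof cases
    case 1
    then have "\<exists>a\<in>A \<inter> X. \<exists>b\<in>X - A \<inter> X. E a b"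
      using X unfolding conn_def by (meson inf_le2)
    then show ?thesis by blast
  next
    case 2
    then have "\<exists>a\<in>A \<inter> Y. \<exists>b\<in>Y - A \<inter> Y. E a b"
      using Y unfolding conn_def by (meson inf_le2)
    then show ?thesis by blast
  qed
qed

text \<open>A cut \<open>A\<close> of \<open>X\<close> extends to a cut of the whole set with
  \<open>Y\<close> on the side of \<open>v\<close>: it is \<open>A\<close> itself if
  \<open>v\<close> is outside \<open>A\<close>, and \<open>A \<union> Y\<close> otherwise. The
  crossing edge then stays in \<open>X\<close>, as the parts meet only at \<open>v\<close>.\<close>

lemma conn_left_of_cut_vertex:
  assumes XY: "conn E (X \<union> Y)" and v: "X \<inter> Y = {v}"
    and no_edge: "\<And>x y. x \<in> X - {v} \<Longrightarrow> y \<in> Y - {v} \<Longrightarrow> \<not> E x y \<and> \<not> E y x"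
  shows "conn E X"
  unfolding conn_def
proof (intro conjI allI impI)
  show "X \<noteq> {}" using v by auto
  fix A assume A: "A \<subseteq> X \<and> A \<noteq> {} \<and> A \<noteq> X"
  show "\<exists>a\<in>A. \<exists>b\<in>X - A. E a b"
  proof (cases "v \<in> A")
    case False
    have "A \<subseteq> X \<union> Y" "A \<noteq> {}" "A \<noteq> X \<union> Y"
      using A False v by auto
    then obtain a b where ab: "a \<in> A" "b \<in> X \<union> Y - A" "E a b"
      using XY unfolding conn_def by meson
    then have "b \<in> X" using no_edge[of a b] A False v by auto
    then show ?thesis using ab by blast
  next
    case True
    have "A \<union> Y \<subseteq> X \<union> Y" "A \<union> Y \<noteq> {}" "A \<union> Y \<noteq> X \<union> Y"
      using A True v by auto
    then obtain a b where ab: "a \<in> A \<union> Y" "b \<in> X \<union> Y - (A \<union> Y)" "E a b"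
      using XY unfolding conn_def by meson
    then have "a \<in> A" using no_edge[of b a] A True v by auto
    then show ?thesis using ab by blast
  qed
qed

lemma conn_deg_pos:
  assumes "conn E S" "finite S" "v \<in> S" "S \<noteq> {v}"
  shows "deg E S v \<ge> 1"
proof -
  have "\<exists>a\<in>{v}. \<exists>b\<in>S - {v}. E a b"
    using assms unfolding conn_def by (metis empty_not_insert empty_subsetI insert_subset)
  then obtain b where "b \<in> S" "E v b" by auto
  then have "{y \<in> S. E v y} \<noteq> {}" by auto
  then show ?thesis unfolding deg_def using assms(2) by (simp add: Suc_leI card_gt_0_iff)
qed

text \<open>
  The weights are chosen such that splitting a connected graph at a cut vertex, which is kept on
  both sides, increases their sum by at most 6; as each of the two pieces has weight at least 6, so
  has the whole graph.
\<close>

definition weight :: "('a \<Rightarrow> 'a \<Rightarrow> bool) \<Rightarrow> 'a set \<Rightarrow> 'a \<Rightarrow> int" where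
  "weight E S x =
     (if conn E (S - {x}) then (if deg E S x = 1 then 3 else 2)
      else if deg E S x \<ge> 3 then -1 else 0)"

lemma sum_weight_ge_6:
  assumes sym: "\<And>x y. E x y \<Longrightarrow> E y x" and irr: "\<And>x. \<not> E x x"
  shows "finite S \<Longrightarrow> conn E S \<Longrightarrow> card S \<ge> 2 \<Longrightarrow> (\<Sum>x\<in>S. weight E S x) \<ge> 6"
proof (induction "card S" arbitrary: S rule: less_induct)
  case less
  show ?case
  proof (cases "\<forall>x\<in>S. conn E (S - {x})")
    case True
    show ?thesis
    proof (cases "card S = 2")
      case two: True
      then obtain a b where ab: "S = {a, b}" "a \<noteq> b" by (meson card_2_iff)
      \<comment> \<open>With two vertices both are leaves of weight 3, the equality case of the
        bound.\<close>
      have "deg E S x = 1" if "x \<in> S" for x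
      proof -
        have "deg E S x \<ge> 1" using conn_deg_pos[OF less.prems(2,1) that] ab by auto
        moreover have "{y \<in> S. E x y} \<subseteq> S - {x}" using irr by auto
        then have "deg E S x \<le> card (S - {x})"
          unfolding deg_def using less.prems(1) by (meson card_mono finite_Diff)
        ultimately show ?thesis using two that less.prems(1) by simp
      qed
      then have "(\<Sum>x\<in>S. weight E S x) = (\<Sum>x\<in>S. 3)"
        using True by (intro sum.cong) (auto simp: weight_def)
      then show ?thesis using two by simp
    next
      case False
      \<comment> \<open>Here there are at least three vertices, each of weight at least 2.\<close>
      have "(\<Sum>x\<in>S. weight E S x) \<ge> (\<Sum>x\<in>S. 2)"
        using True by (intro sum_mono) (auto simp: weight_def)
      then show ?thesis using False less.prems(3) by simp
    qed
  next
    case False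
    then obtain v where v: "v \<in> S" "\<not> conn E (S - {v})" by auto
    have "S - {v} \<noteq> {}"
    proof
      assume "S - {v} = {}"
      then have "S = {v}" using v by auto
      then show False using less.prems(3) by simp
    qed
    then obtain A where A: "A \<subseteq> S - {v}" "A \<noteq> {}" "A \<noteq> S - {v}"
      and nA: "\<And>a b. a \<in> A \<Longrightarrow> b \<in> S - {v} - A \<Longrightarrow> \<not> E a b"
      using v(2) unfolding conn_def by blast
    define B where "B = S - {v} - A"
    define X where "X = insert v A"
    define Y where "Y = insert v B"
    have B: "B \<noteq> {}" using A B_def by auto
    have fin: "finite A" "finite B" "finite X" "finite Y"
      using less.prems(1) A(1) by (auto simp: B_def X_def Y_def dest: finite_subset)
    have nv: "v \<notin> A" "v \<notin> B" "A \<inter> B = {}" using A by (auto simp: B_def)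
    have S: "S = X \<union> Y" using v A by (auto simp: B_def X_def Y_def)
    have ne: "\<not> E a b \<and> \<not> E b a" if "a \<in> A" "b \<in> B" for a b
      using nA that sym by (auto simp: B_def)
    have cX: "conn E X"
      by (rule conn_left_of_cut_vertex[of E X Y v])
        (use less.prems(2) S nv ne in \<open>auto simp: X_def Y_def\<close>)
    have cY: "conn E Y"
      by (rule conn_left_of_cut_vertex[of E Y X v])
        (use less.prems(2) S nv ne in \<open>auto simp: X_def Y_def Un_commute\<close>)
    have "card S = card A + card B + 1"
      using S nv fin by (simp add: X_def Y_def card_Un_disjoint)
    moreover have "card X = card A + 1" "card Y = card B + 1"
      using nv fin by (simp_all add: X_def Y_def)
    moreover have "card A > 0" "card B > 0" using A B fin by (simp_all add: card_gt_0_iff)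
    ultimately have cards: "card X < card S" "card Y < card S" "card X \<ge> 2" "card Y \<ge> 2"
      by linarith+
    have IH: "(\<Sum>x\<in>X. weight E X x) \<ge> 6" "(\<Sum>x\<in>Y. weight E Y x) \<ge> 6"
      using less.hyps cards cX cY fin by blast+
    \<comment> \<open>Away from \<open>v\<close> nothing changes: \<open>x\<close> keeps its
      neighbours, and gluing the connected piece \<open>Y\<close> at \<open>v\<close> neither
      creates nor destroys connectedness of what remains after deleting \<open>x\<close>.\<close>
    have wA: "weight E S x = weight E X x" if x: "x \<in> A" for x
    proof -
      have "{y \<in> S. E x y} = {y \<in> X. E x y}"
        using ne x S by (auto simp: X_def Y_def)
      then have "deg E S x = deg E X x" by (simp add: deg_def)
      moreover have eq: "S - {x} = (X - {x}) \<union> Y"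
        using S x nv by (auto simp: X_def Y_def)
      have "conn E (S - {x}) \<longleftrightarrow> conn E (X - {x})"
      proof
        assume "conn E (S - {x})"
        then show "conn E (X - {x})"
          unfolding eq
          by (rule conn_left_of_cut_vertex[where v = v])
            (use nv x ne in \<open>auto simp: X_def Y_def\<close>)
      next
        assume "conn E (X - {x})"
        then show "conn E (S - {x})"
          unfolding eq by (rule conn_Un[where v = v]) (use nv x cY in \<open>auto simp: X_def Y_def\<close>)
      qed
      ultimately show ?thesis by (simp add: weight_def)
    qed
    have wB: "weight E S x = weight E Y x" if x: "x \<in> B" for x
    proof -
      have "{y \<in> S. E x y} = {y \<in> Y. E x y}"
        using ne x S by (auto simp: X_def Y_def)
      then have "deg E S x = deg E Y x" by (simp add: deg_def)
      moreover have eq: "S - {x} = (Y - {x}) \<union> X"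
        using S x nv by (auto simp: X_def Y_def)
      have "conn E (S - {x}) \<longleftrightarrow> conn E (Y - {x})"
      proof
        assume "conn E (S - {x})"
        then show "conn E (Y - {x})"
          unfolding eq
          by (rule conn_left_of_cut_vertex[where v = v])
            (use nv x ne in \<open>auto simp: X_def Y_def\<close>)
      next
        assume "conn E (Y - {x})"
        then show "conn E (S - {x})"
          unfolding eq by (rule conn_Un[where v = v]) (use nv x cX in \<open>auto simp: X_def Y_def\<close>)
      qed
      ultimately show ?thesis by (simp add: weight_def)
    qed
    have "{y \<in> S. E v y} = {y \<in> X. E v y} \<union> {y \<in> Y. E v y}"
      "{y \<in> X. E v y} \<inter> {y \<in> Y. E v y} = {}"
      using S nv irr by (auto simp: X_def Y_def)
    then have dv: "deg E S v = deg E X v + deg E Y v"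
      unfolding deg_def using fin by (simp add: card_Un_disjoint)
    have dX: "deg E X v \<ge> 1"
      by (rule conn_deg_pos) (use cX fin A nv in \<open>auto simp: X_def\<close>)
    have dY: "deg E Y v \<ge> 1"
      by (rule conn_deg_pos) (use cY fin B nv in \<open>auto simp: Y_def\<close>)
    \<comment> \<open>Each weight at \<open>v\<close> in a piece is at most 3. If both are 3, then
      \<open>v\<close> has degree 2 in \<open>S\<close>, hence weight 0 there. If its weight in
      \<open>S\<close> is -1, it has degree at least 2 in one piece, hence weight at most 2 in that
      piece.\<close>
    have wv: "weight E X v + weight E Y v - weight E S v \<le> 6"
      using v(2) dv dX dY by (auto simp: weight_def)
    have "S = insert v (A \<union> B)" using S by (auto simp: X_def Y_def)
    then have "(\<Sum>x\<in>S. weight E S x) = weight E S v + (\<Sum>x\<in>A. weight E S x) + (\<Sum>x\<in>B. weight E S x)"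
      using nv fin by (simp add: sum.union_disjoint)
    moreover have "(\<Sum>x\<in>X. weight E X x) = weight E X v + (\<Sum>x\<in>A. weight E S x)"
      using nv fin wA by (simp add: X_def)
    moreover have "(\<Sum>x\<in>Y. weight E Y x) = weight E Y v + (\<Sum>x\<in>B. weight E S x)"
      using nv fin wB by (simp add: Y_def)
    ultimately show ?thesis using IH wv by linarith
  qed
qed

text \<open>Pointwise, \<open>weight\<close> is at most 4 times the indicator of non-cut vertices
  minus the indicator of degree at least 3; the sum of the weights is positive by
  \<open>sum_weight_ge_6\<close>.\<close>

lemma card_deg_ge_3_le:
  assumes sym: "\<And>x y. E x y \<Longrightarrow> E y x" and irr: "\<And>x. \<not> E x x"
    and S: "finite S" "conn E S" "card S \<ge> 2"
  shows "card {x \<in> S. deg E S x \<ge> 3} \<le> 4 * card {x \<in> S. conn E (S - {x})}"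
proof -
  define L where "L = {x \<in> S. conn E (S - {x})}"
  define D where "D = {x \<in> S. deg E S x \<ge> 3}"
  have fin: "finite L" "finite D" using S by (auto simp: L_def D_def)
  have LD: "L \<subseteq> S" "D \<subseteq> S" by (auto simp: L_def D_def)
  have "6 \<le> (\<Sum>x\<in>S. weight E S x)"
    using sum_weight_ge_6[OF sym irr S] .
  also have "\<dots> \<le> (\<Sum>x\<in>S. (if x \<in> L then 4 else 0) - (if x \<in> D then 1 else 0))"
    by (intro sum_mono) (auto simp: weight_def L_def D_def)
  also have "\<dots> = 4 * int (card L) - int (card D)"
    using S(1) LD by (simp add: sum_subtractf sum.If_cases Int_absorb1)
  finally show ?thesis unfolding L_def D_def by linarith
qed

section \<open>Minimal connected dominating sets and sparse vertices\<close>

definition cds :: "'a set \<Rightarrow> ('a \<Rightarrow> 'a \<Rightarrow> bool) \<Rightarrow> 'a set \<Rightarrow> bool" where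
  "cds V E S \<longleftrightarrow> S \<subseteq> V \<and> (\<forall>v\<in>V - S. \<exists>u\<in>S. E v u) \<and> conn E S"

definition sparse :: "'a set \<Rightarrow> ('a \<Rightarrow> 'a \<Rightarrow> bool) \<Rightarrow> 'a set \<Rightarrow> 'a set" where
  "sparse V E S = {v \<in> V. deg E S v \<le> 2}"

text \<open>Connectivity and cut vertices refer to \<open>E\<close>, sparsity to the subrelation
  \<open>E'\<close>. Degrees in \<open>E'\<close> are no larger, so private neighbours, and vertices
  of \<open>S\<close> with \<open>E\<close>-degree at most 2, are sparse for \<open>E'\<close>. This
  gives |S| \<le> 4|L| + |A| and |L| \<le> |A|.\<close>

lemma cds_card_le_sparse:
  assumes sym: "\<And>x y. E x y \<Longrightarrow> E y x" and irr: "\<And>x. \<not> E x x" and "finite V"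
    and sub: "\<And>x y. E' x y \<Longrightarrow> E x y"
    and S: "cds V E S" and min: "\<And>v. v \<in> S \<Longrightarrow> \<not> cds V E (S - {v})"
  shows "card S \<le> 5 * card (sparse V E' S)"
proof (cases "card S \<ge> 2")
  case False
  have SV: "S \<subseteq> V" "S \<noteq> {}" using S by (auto simp: cds_def conn_def)
  have finS: "finite S" using SV \<open>finite V\<close> finite_subset by auto
  have "deg E' S v \<le> 2" for v
  proof -
    have "deg E' S v \<le> card S" unfolding deg_def by (rule card_mono) (use finS in auto)
    then show ?thesis using False by linarith
  qed
  then have "sparse V E' S = V" by (auto simp: sparse_def)
  moreover have "card S \<le> card V" using SV \<open>finite V\<close> by (simp add: card_mono)
  ultimately show ?thesis by simp
next
  case True
  have SV: "S \<subseteq> V" and dom: "\<forall>v\<in>V - S. \<exists>u\<in>S. E v u" and c: "conn E S"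
    using S by (auto simp: cds_def)
  have finS: "finite S" using SV \<open>finite V\<close> finite_subset by auto
  define A where "A = sparse V E' S"
  have finA: "finite A" using \<open>finite V\<close> by (simp add: A_def sparse_def)
  have deg_le: "deg E' S v \<le> deg E S v" for v
    unfolding deg_def using finS sub by (intro card_mono) auto
  define L where "L = {x \<in> S. conn E (S - {x})}"
  \<comment> \<open>Deleting \<open>v\<close> keeps connectedness, so domination fails at some
    \<open>u\<close>. It is not \<open>v\<close>, which has a neighbour in \<open>S\<close> because
    \<open>S\<close> is connected with at least two vertices. Hence \<open>u\<close> lies outside
    \<open>S\<close> and \<open>v\<close> is its only neighbour in \<open>S\<close>.\<close>
  have "\<exists>u\<in>V. {y \<in> S. E u y} = {v}" if v: "v \<in> L" for v
  proof -
    have "\<not> cds V E (S - {v})" "conn E (S - {v})" using min v by (auto simp: L_def)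
    then obtain u where u: "u \<in> V" "u \<notin> S - {v}" "\<forall>y\<in>S - {v}. \<not> E u y"
      using SV unfolding cds_def by blast
    have "u \<noteq> v"
    proof
      assume uv: "u = v"
      have "{y \<in> S. E v y} = {}" using u uv irr by auto
      then have "deg E S v = 0" unfolding deg_def by (simp only: card.empty)
      moreover have "deg E S v \<ge> 1"
        by (rule conn_deg_pos) (use c finS v True in \<open>auto simp: L_def\<close>)
      ultimately show False by simp
    qed
    then have "u \<in> V - S" using u by auto
    then have "{y \<in> S. E u y} = {v}" using dom u by auto
    then show ?thesis using u by auto
  qed
  then obtain p where p: "\<And>v. v \<in> L \<Longrightarrow> p v \<in> V \<and> {y \<in> S. E (p v) y} = {v}" by metis
  have "inj_on p L"
  proof (rule inj_onI)
    fix v w assume vw: "v \<in> L" "w \<in> L" "p v = p w"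
    have "{v} = {y \<in> S. E (p v) y}" by (rule HOL.sym) (rule conjunct2[OF p[OF vw(1)]])
    also have "\<dots> = {w}" unfolding vw(3) using p[OF vw(2)] by (rule conjunct2)
    finally show "v = w" by simp
  qed
  moreover have "p ` L \<subseteq> A"
  proof (rule image_subsetI)
    fix v assume "v \<in> L"
    then have "p v \<in> V" "{y \<in> S. E (p v) y} = {v}" using p by blast+
    then have "p v \<in> V" "deg E S (p v) = 1" by (simp_all only: deg_def is_singletonI is_singleton_altdef[symmetric])
    then show "p v \<in> A" using deg_le[of "p v"] by (auto simp: A_def sparse_def)
  qed
  ultimately have L: "card L \<le> card A" using finA by (simp add: card_inj_on_le)
  have "S \<subseteq> {x \<in> S. deg E S x \<ge> 3} \<union> A"
  proof
    fix x assume x: "x \<in> S"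
    then have "deg E S x \<ge> 3 \<or> deg E' S x \<le> 2" using deg_le[of x] by linarith
    then show "x \<in> {x \<in> S. deg E S x \<ge> 3} \<union> A" using x SV by (auto simp: A_def sparse_def)
  qed
  then have "card S \<le> card ({x \<in> S. deg E S x \<ge> 3} \<union> A)"
    using finA finS by (intro card_mono) auto
  also have "\<dots> \<le> card {x \<in> S. deg E S x \<ge> 3} + card A" by (rule card_Un_le)
  finally have "card S \<le> card {x \<in> S. deg E S x \<ge> 3} + card A" .
  moreover have "card {x \<in> S. deg E S x \<ge> 3} \<le> 4 * card L"
    unfolding L_def by (rule card_deg_ge_3_le) (use sym irr finS c True in auto)
  ultimately show ?thesis using L unfolding A_def by linarith
qed

text \<open>A cut of \<open>S\<close> either splits \<open>R\<close> and is crossed inside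
  \<open>R\<close>, or has \<open>R\<close> on one side, and then any vertex of the other side is
  joined to \<open>R\<close>. It serves both for supersets of connected dominating sets and for the
  rounds of the component search.\<close>

lemma conn_extend:
  assumes sym: "\<And>x y. E x y \<Longrightarrow> E y x"
    and R: "conn E R" "R \<subseteq> S" and nb: "\<And>y. y \<in> S - R \<Longrightarrow> \<exists>r\<in>R. E y r"
  shows "conn E S"
  unfolding conn_def
proof (intro conjI allI impI)
  show "S \<noteq> {}" using R by (auto simp: conn_def)
  fix A assume A: "A \<subseteq> S \<and> A \<noteq> {} \<and> A \<noteq> S"
  consider "A \<inter> R \<noteq> {} \<and> A \<inter> R \<noteq> R" | "A \<inter> R = {}" | "R \<subseteq> A" by blast
  then show "\<exists>a\<in>A. \<exists>b\<in>S - A. E a b"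
  proof cases
    case 1
    then have "\<exists>a\<in>A \<inter> R. \<exists>b\<in>R - A \<inter> R. E a b"
      using R(1) unfolding conn_def by (meson inf_le2)
    then show ?thesis using R(2) by blast
  next
    case 2
    then obtain a where "a \<in> A" "a \<in> S - R" using A by blast
    then show ?thesis using nb[of a] 2 R(2) by blast
  next
    case 3
    then obtain b where b: "b \<in> S - A" "b \<in> S - R" using A by blast
    then obtain r where "r \<in> R" "E b r" using nb by blast
    then show ?thesis using 3 b sym by blast
  qed
qed

lemma cds_superset:
  assumes sym: "\<And>x y. E x y \<Longrightarrow> E y x" and T: "cds V E T" "T \<subseteq> S" "S \<subseteq> V"
  shows "cds V E S"
  unfolding cds_def
proof (intro conjI)
  show "S \<subseteq> V" by fact
  show "\<forall>v\<in>V - S. \<exists>u\<in>S. E v u" using T unfolding cds_def by blast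
  show "conn E S"
    by (rule conn_extend[of E T]) (use T sym in \<open>auto simp: cds_def\<close>)
qed

definition minimal_connected :: "'a set \<Rightarrow> ('a \<Rightarrow> 'a \<Rightarrow> bool) \<Rightarrow> 'a set \<Rightarrow> bool" where
  "minimal_connected V E S \<longleftrightarrow> cds V E S \<and> (\<forall>v\<in>S. \<not> cds V E (S - {v}))"

text \<open>A smaller connected dominating set \<open>T\<close> misses some \<open>v\<close> of
  \<open>S\<close>; then \<open>S - {v}\<close> contains \<open>T\<close> and is one as well by
  \<open>cds_superset\<close>.\<close>

lemma minimal_connected_iff:
  assumes sym: "\<And>x y. E x y \<Longrightarrow> E y x"
  shows "minimal_connected V E S \<longleftrightarrow> cds V E S \<and> (\<forall>T. T \<subset> S \<longrightarrow> \<not> cds V E T)"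
proof
  assume m: "minimal_connected V E S"
  have "\<not> cds V E T" if T: "T \<subset> S" for T
  proof
    assume c: "cds V E T"
    obtain v where v: "v \<in> S" "v \<notin> T" using T by auto
    have "cds V E (S - {v})"
      by (rule cds_superset[OF sym c]) (use T v m in \<open>auto simp: minimal_connected_def cds_def\<close>)
    then show False using m v by (auto simp: minimal_connected_def)
  qed
  then show "cds V E S \<and> (\<forall>T. T \<subset> S \<longrightarrow> \<not> cds V E T)"
    using m by (auto simp: minimal_connected_def)
next
  assume "cds V E S \<and> (\<forall>T. T \<subset> S \<longrightarrow> \<not> cds V E T)"
  then show "minimal_connected V E S"
    unfolding minimal_connected_def by (metis Diff_subset insert_Diff psubsetI insertI1 Diff_iff singletonI)
qed

section \<open>Counting by bounded differences\<close>

text \<open>On the unit interval exp y and exp (-y) are bounded by quadratic polynomials whose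
  linear terms cancel, and the sum 2 + 2y^2 is at most 2 exp (y^2).\<close>

lemma exp_add_exp_minus_le:
  fixes x :: real
  assumes "\<bar>x\<bar> \<le> 1"
  shows "exp x + exp (- x) \<le> 2 * exp (x\<^sup>2)"
proof -
  have *: "exp y + exp (- y) \<le> 2 * exp (y\<^sup>2)" if y: "0 \<le> y" "y \<le> 1" for y :: real
  proof -
    have "exp y \<le> 1 + y + y\<^sup>2" using exp_bound y by simp
    moreover have "exp (- y) \<le> 1 - y + y\<^sup>2"
    proof -
      \<comment> \<open>The product is 1 + y^3.\<close>
      have "1 \<le> (1 - y + y\<^sup>2) * (1 + y)"
        using y by (simp add: algebra_simps power2_eq_square)
      also have "\<dots> \<le> (1 - y + y\<^sup>2) * exp y"
        using y by (intro mult_left_mono exp_ge_add_one_self) (simp_all add: power2_eq_square)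
      finally show ?thesis by (simp add: exp_minus field_simps)
    qed
    moreover have "1 + y\<^sup>2 \<le> exp (y\<^sup>2)" by (rule exp_ge_add_one_self)
    ultimately show ?thesis by linarith
  qed
  show ?thesis
  proof (cases "0 \<le> x")
    case True
    then show ?thesis using *[of x] assms by simp
  next
    case False
    then show ?thesis using *[of "- x"] assms by simp
  qed
qed

lemma sum_Pow_insert:
  fixes f :: "'a set \<Rightarrow> 'b :: comm_monoid_add"
  assumes "finite V" "v \<notin> V"
  shows "(\<Sum>S\<in>Pow (insert v V). f S) = (\<Sum>S\<in>Pow V. f S + f (insert v S))"
proof -
  have "inj_on (insert v) (Pow V)" using assms(2) by (auto simp: inj_on_def)
  moreover have "Pow V \<inter> insert v ` Pow V = {}" using assms(2) by auto
  ultimately show ?thesis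
    using assms(1) by (simp add: Pow_insert sum.union_disjoint sum.reindex sum.distrib)
qed

text \<open>
  The exponential moment form of McDiarmid's inequality for uniformly random subsets: averaging over
  the membership of one element preserves both the mean and the bound on the differences.
\<close>

lemma exp_moment_bounded_differences:
  fixes f :: "'a set \<Rightarrow> real"
  assumes "finite V" and c: "\<And>S v. S \<subseteq> V \<Longrightarrow> v \<in> V \<Longrightarrow> v \<notin> S \<Longrightarrow> \<bar>f (insert v S) - f S\<bar> \<le> c"
    and l: "0 \<le> l" "l * c \<le> 2"
  shows "(\<Sum>S\<in>Pow V. exp (l * f S)) \<le>
    2 ^ card V * exp (l * ((\<Sum>S\<in>Pow V. f S) / 2 ^ card V) + card V * (l * c / 2)\<^sup>2)"
  using assms(1) c
proof (induction V arbitrary: f rule: finite_induct)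
  case empty
  then show ?case by simp
next
  case (insert v V)
  define F where "F S = (f S + f (insert v S)) / 2" for S
  define q where "q = (l * c / 2)\<^sup>2"
  have step: "exp (l * f S) + exp (l * f (insert v S)) \<le> 2 * exp q * exp (l * F S)"
    if S: "S \<in> Pow V" for S
  proof -
    \<comment> \<open>The two values of \<open>l * f\<close> deviate from their mean
      \<open>l * F S\<close> by \<open>y\<close> and \<open>- y\<close>; the assumption
      \<open>l * c \<le> 2\<close> keeps \<open>y\<close> within the range of
      \<open>exp_add_exp_minus_le\<close>.\<close>
    define y where "y = l * (f (insert v S) - f S) / 2"
    have "\<bar>f (insert v S) - f S\<bar> \<le> c"
      using insert.prems[of S v] S insert.hyps by auto
    then have y: "\<bar>y\<bar> \<le> l * c / 2"
      using l by (simp add: y_def abs_mult mult_left_mono)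
    then have "y\<^sup>2 \<le> q" unfolding q_def by (rule power2_le_iff_abs_le[THEN iffD2, rotated]) (use y in linarith)
    have "exp y + exp (- y) \<le> 2 * exp (y\<^sup>2)"
      using y l by (intro exp_add_exp_minus_le) linarith
    also have "\<dots> \<le> 2 * exp q" using \<open>y\<^sup>2 \<le> q\<close> by simp
    finally have "(exp y + exp (- y)) * exp (l * F S) \<le> 2 * exp q * exp (l * F S)"
      by (simp add: mult_right_mono)
    moreover have "l * f (insert v S) = y + l * F S" "l * f S = - y + l * F S"
      by (simp_all add: y_def F_def field_simps)
    ultimately show ?thesis by (simp only: exp_add algebra_simps)
  qed
  have mean: "(\<Sum>S\<in>Pow (insert v V). f S) / 2 ^ card (insert v V) = (\<Sum>S\<in>Pow V. F S) / 2 ^ card V"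
    using insert.hyps by (simp add: sum_Pow_insert F_def sum_divide_distrib[symmetric])
  have cF: "\<bar>F (insert u S) - F S\<bar> \<le> c" if "S \<subseteq> V" "u \<in> V" "u \<notin> S" for S u
  proof -
    have "\<bar>f (insert u S) - f S\<bar> \<le> c" using insert.prems[of S u] that by auto
    moreover have "\<bar>f (insert u (insert v S)) - f (insert v S)\<bar> \<le> c"
      using insert.prems[of "insert v S" u] that insert.hyps by auto
    ultimately show ?thesis
      unfolding F_def insert_commute[of v u S] abs_le_iff by (simp add: field_simps)
  qed
  have "(\<Sum>S\<in>Pow (insert v V). exp (l * f S)) = (\<Sum>S\<in>Pow V. exp (l * f S) + exp (l * f (insert v S)))"
    using insert.hyps by (simp add: sum_Pow_insert)
  also have "\<dots> \<le> (\<Sum>S\<in>Pow V. 2 * exp q * exp (l * F S))"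
    by (intro sum_mono step)
  also have "\<dots> = 2 * exp q * (\<Sum>S\<in>Pow V. exp (l * F S))"
    by (simp add: sum_distrib_left)
  also have "\<dots> \<le> 2 * exp q * (2 ^ card V * exp (l * ((\<Sum>S\<in>Pow V. F S) / 2 ^ card V) + card V * q))"
    unfolding q_def by (intro mult_left_mono insert.IH cF) auto
  also have "\<dots> = 2 ^ card (insert v V) *
      exp (l * ((\<Sum>S\<in>Pow V. F S) / 2 ^ card V) + card (insert v V) * q)"
    using insert.hyps by (simp add: exp_add algebra_simps)
  finally show ?case by (simp only: mean q_def)
qed

text \<open>Splitting \<open>S\<close> into \<open>S \<inter> M\<close> and \<open>S - M\<close> is
  a bijection onto pairs. The factor \<open>2 ^ card M\<close> stands on the left so that no
  subtraction occurs in an exponent.\<close>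

lemma card_subsets_few_in:
  assumes "finite V" "M \<subseteq> V"
  shows "card {S \<in> Pow V. card (S \<inter> M) \<le> k} * 2 ^ card M = 2 ^ card V * (\<Sum>j\<le>k. card M choose j)"
proof -
  have fM: "finite M" using assms finite_subset by blast
  have e: "(A \<union> B) \<inter> M = A" "A \<union> B - M = B" if "A \<subseteq> M" "B \<subseteq> V - M" for A B
    using that by auto
  have "bij_betw (\<lambda>S. (S \<inter> M, S - M)) {S \<in> Pow V. card (S \<inter> M) \<le> k} ({A \<in> Pow M. card A \<le> k} \<times> Pow (V - M))"
    by (rule bij_betwI[where g = "\<lambda>(A, B). A \<union> B"])
      (use assms in \<open>auto simp: e\<close>)
  then have "card {S \<in> Pow V. card (S \<inter> M) \<le> k} = card {A \<in> Pow M. card A \<le> k} * 2 ^ (card V - card M)"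
    using assms fM by (simp add: bij_betw_same_card card_cartesian_product card_Pow card_Diff_subset)
  moreover have "card {A \<in> Pow M. card A \<le> k} = (\<Sum>j\<le>k. card M choose j)"
  proof -
    have "{A \<in> Pow M. card A \<le> k} = (\<Union>j\<le>k. {A. A \<subseteq> M \<and> card A = j})" by auto
    then have "card {A \<in> Pow M. card A \<le> k} = (\<Sum>j\<le>k. card {A. A \<subseteq> M \<and> card A = j})"
      using fM by (simp only:) (rule card_UN_disjoint, auto)
    then show ?thesis using fM by (simp add: n_subsets)
  qed
  moreover have "card M \<le> card V" using assms by (simp add: card_mono)
  ultimately show ?thesis by (simp add: power_add[symmetric])
qed

text \<open>Only 14 elements of \<open>N\<close> are kept, which enlarges the counted family; the
  binomial sum is 1 + 14 + 91 = 106.\<close>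

lemma card_subsets_at_most_2_of_14:
  assumes "finite V" "N \<subseteq> V" "card N \<ge> 14"
  shows "real (card {S \<in> Pow V. card (S \<inter> N) \<le> 2}) \<le> 106 / 2 ^ 14 * 2 ^ card V"
proof -
  have fN: "finite N" using assms finite_subset by blast
  obtain M where M: "M \<subseteq> N" "card M = 14"
    using assms(3) by (meson obtain_subset_with_card_n)
  have "card (S \<inter> M) \<le> 2" if "card (S \<inter> N) \<le> 2" for S
    using that M fN by (meson Int_mono card_mono finite_Int order_refl order_trans)
  then have "card {S \<in> Pow V. card (S \<inter> N) \<le> 2} \<le> card {S \<in> Pow V. card (S \<inter> M) \<le> 2}"
    using assms(1) by (intro card_mono) auto
  moreover have "card {S \<in> Pow V. card (S \<inter> M) \<le> 2} * 2 ^ 14 = 2 ^ card V * 106"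
  proof -
    have "(\<Sum>j\<le>2. (14::nat) choose j) = 106" 
    proof -
      have "{..2::nat} = {0, 1, 2}" by auto
      then show ?thesis by (simp add: choose_two)
    qed
    then show ?thesis using card_subsets_few_in[OF assms(1), of M 2] M assms(2) by simp
  qed
  then have "real (card {S \<in> Pow V. card (S \<inter> M) \<le> 2} * 2 ^ 14) = real (2 ^ card V * 106)"
    by (simp only:)
  ultimately show ?thesis by (simp add: field_simps)
qed

lemma sum_card_Pow:
  assumes "finite V"
  shows "(\<Sum>S\<in>Pow V. real (card S)) = card V / 2 * 2 ^ card V"
  using assms
proof (induction V rule: finite_induct)
  case (insert v V)
  have "(\<Sum>S\<in>Pow V. real (card (insert v S))) = (\<Sum>S\<in>Pow V. real (card S) + 1)"
  proof (rule sum.cong)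
    fix S assume "S \<in> Pow V"
    then have "finite S" "v \<notin> S" using insert.hyps finite_subset by auto
    then show "real (card (insert v S)) = real (card S) + 1" by simp
  qed simp
  then show ?case
    using insert by (simp add: sum_Pow_insert sum.distrib card_Pow algebra_simps)
qed simp

section \<open>The family containing all minimal connected dominating sets, and its size\<close>

definition small_family :: "'a set \<Rightarrow> ('a \<Rightarrow> 'a \<Rightarrow> bool) \<Rightarrow> 'a set set" where
  "small_family V E = {S \<in> Pow V. card S \<le> 5 * card (sparse V E S)}"

lemma sparse_antimono:
  assumes "finite T" "S \<subseteq> T"
  shows "sparse V E T \<subseteq> sparse V E S"
proof -
  have "deg E S v \<le> deg E T v" for v
    unfolding deg_def using assms by (intro card_mono) auto
  then show ?thesis unfolding sparse_def using order_trans by blast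
qed

text \<open>Passing to a subset lowers \<open>card S\<close> and enlarges \<open>sparse\<close>.
  This makes it safe to cut off the search at a set outside the family.\<close>

lemma small_family_subset_closed:
  assumes "finite V" "T \<in> small_family V E" "S \<subseteq> T"
  shows "S \<in> small_family V E"
proof -
  have T: "T \<subseteq> V" "card T \<le> 5 * card (sparse V E T)" "finite T"
    using assms finite_subset by (auto simp: small_family_def)
  have "card S \<le> card T" using T assms(3) by (simp add: card_mono)
  moreover have "card (sparse V E T) \<le> card (sparse V E S)"
    using sparse_antimono[OF T(3) assms(3)] assms(1) by (intro card_mono) (auto simp: sparse_def)
  ultimately show ?thesis using T assms(3) by (auto simp: small_family_def)
qed

text \<open>Exponential Markov bound for f = 5|A| - |S|: the family consists of the sets with f
  \<ge> 0, while the mean of f is at most -n/4.\<close>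

lemma card_small_family_le:
  assumes fin: "finite V"
    and sym: "\<And>x y. E x y \<Longrightarrow> E y x"
    and d: "\<And>v. v \<in> V \<Longrightarrow> deg E V v \<le> 3 * 10 ^ 5"
    and low: "real (card {v \<in> V. deg E V v < 14}) < 1 / 60 * card V"
  shows "real (card (small_family V E)) \<le> 2 powr (card V * (1 - 1 / 10 ^ 26))"
proof -
  define n where "n = card V"
  define f where "f S = 5 * real (card (sparse V E S)) - real (card S)" for S
  \<comment> \<open>With \<open>c\<close> about 1.5e6, the gain l/4 = 2.5e-14 per vertex exceeds the
    loss (l c / 2)^2, about 5.6e-15, by far more than 1e-26.\<close>
  define l :: real where "l = 1 / 10 ^ 13"
  define c :: real where "c = 5 * (3 * 10 ^ 5) + 1"
  \<comment> \<open>Adding \<open>v\<close> can change sparsity only at the neighbours of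
    \<open>v\<close>, at most 3e5 many, and changes \<open>card S\<close> by 1.\<close>
  have diff: "\<bar>f (insert v S) - f S\<bar> \<le> c" if S: "S \<subseteq> V" "v \<in> V" "v \<notin> S" for S v
  proof -
    have fS: "finite S" using S fin finite_subset by auto
    have sub: "sparse V E (insert v S) \<subseteq> sparse V E S" using fS by (intro sparse_antimono) auto
    have fsp: "finite (sparse V E S)" using fin by (simp add: sparse_def)
    have "sparse V E S - sparse V E (insert v S) \<subseteq> {y \<in> V. E v y}"
    proof
      fix x assume x: "x \<in> sparse V E S - sparse V E (insert v S)"
      then have "deg E (insert v S) x \<noteq> deg E S x" by (auto simp: sparse_def)
      then have "{y \<in> insert v S. E x y} \<noteq> {y \<in> S. E x y}" unfolding deg_def by metis
      then have "E x v" by auto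
      then show "x \<in> {y \<in> V. E v y}" using sym x by (auto simp: sparse_def)
    qed
    then have "card (sparse V E S - sparse V E (insert v S)) \<le> deg E V v"
      unfolding deg_def using fin by (intro card_mono) auto
    moreover have "deg E V v \<le> 3 * 10 ^ 5" using d S by auto
    ultimately have "card (sparse V E S) - card (sparse V E (insert v S)) \<le> 3 * 10 ^ 5"
      using sub fsp by (simp add: card_Diff_subset finite_subset)
    moreover have "card (sparse V E (insert v S)) \<le> card (sparse V E S)"
      using sub fsp by (rule card_mono[rotated])
    moreover have "card (insert v S) = card S + 1" using fS S by simp
    ultimately show ?thesis unfolding f_def c_def by simp
  qed
  have each: "real (card {S \<in> Pow V. v \<in> sparse V E S}) \<le>
      2 ^ n * ((if deg E V v < 14 then 1 else 0) + 106 / 2 ^ 14)" if v: "v \<in> V" for v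
  proof (cases "deg E V v < 14")
    case True
    have "card {S \<in> Pow V. v \<in> sparse V E S} \<le> card (Pow V)" using fin by (intro card_mono) auto
    then have "real (card {S \<in> Pow V. v \<in> sparse V E S}) \<le> real (card (Pow V))"
      by (simp only: of_nat_le_iff)
    also have "\<dots> = 2 ^ n * 1" using fin by (simp add: card_Pow n_def)
    also have "\<dots> \<le> 2 ^ n * (1 + 106 / 2 ^ 14)" by (intro mult_left_mono) auto
    finally show ?thesis using True by simp
  next
    case False
    define N where "N = {y \<in> V. E v y}"
    have "{S \<in> Pow V. v \<in> sparse V E S} = {S \<in> Pow V. card (S \<inter> N) \<le> 2}"
    proof -
      have "{y \<in> S. E v y} = S \<inter> N" if "S \<subseteq> V" for S using that by (auto simp: N_def)
      then show ?thesis using v by (auto simp: sparse_def deg_def)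
    qed
    moreover have "card N \<ge> 14" using False by (simp add: N_def deg_def)
    ultimately show ?thesis
      using card_subsets_at_most_2_of_14[of V N] fin False by (auto simp: N_def n_def mult.commute)
  qed
  \<comment> \<open>Double counting: pairs of a set and a vertex sparse for it are counted by the
    vertex.\<close>
  have "(\<Sum>S\<in>Pow V. real (card (sparse V E S))) = (\<Sum>S\<in>Pow V. \<Sum>v\<in>V. if v \<in> sparse V E S then 1 else 0)"
    using fin by (intro sum.cong) (auto simp: sum.If_cases sparse_def Int_def)
  also have "\<dots> = (\<Sum>v\<in>V. \<Sum>S\<in>Pow V. if v \<in> sparse V E S then 1 else 0)" by (rule sum.swap)
  also have "\<dots> = (\<Sum>v\<in>V. real (card {S \<in> Pow V. v \<in> sparse V E S}))"
    using fin by (simp add: sum.If_cases Int_def)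
  also have "\<dots> \<le> (\<Sum>v\<in>V. 2 ^ n * ((if deg E V v < 14 then 1 else 0) + 106 / 2 ^ 14))"
    by (intro sum_mono each)
  also have "\<dots> = 2 ^ n * (card {v \<in> V. deg E V v < 14} + n * (106 / 2 ^ 14))"
    using fin by (simp add: sum_distrib_left[symmetric] sum.distrib sum.If_cases Int_def n_def)
  \<comment> \<open>1/60 + 106/2^14 is about 0.0231, below 1/20. The mean of \<open>f\<close> per
    vertex is then at most 5/20 - 1/2 = -1/4.\<close>
  also have "\<dots> \<le> 2 ^ n * (n * (1 / 20))"
    using low by (intro mult_left_mono) (simp_all add: n_def)
  finally have "5 * (\<Sum>S\<in>Pow V. real (card (sparse V E S))) \<le> 2 ^ n * (5 * (n * (1 / 20)))"
    by simp
  moreover have "(\<Sum>S\<in>Pow V. f S) = 5 * (\<Sum>S\<in>Pow V. real (card (sparse V E S))) - n / 2 * 2 ^ n"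
    using sum_card_Pow[OF fin] by (simp add: f_def sum_subtractf sum_distrib_left n_def)
  ultimately have "(\<Sum>S\<in>Pow V. f S) \<le> 2 ^ n * (5 * (n * (1 / 20))) - n / 2 * 2 ^ n"
    by linarith
  then have mean: "(\<Sum>S\<in>Pow V. f S) / 2 ^ n \<le> - n / 4"
    by (simp add: field_simps)
  have "real (card (small_family V E)) = (\<Sum>S\<in>small_family V E. 1)" by simp
  also have "\<dots> \<le> (\<Sum>S\<in>small_family V E. exp (l * f S))"
    by (intro sum_mono) (auto simp: small_family_def f_def l_def)
  also have "\<dots> \<le> (\<Sum>S\<in>Pow V. exp (l * f S))"
    using fin by (intro sum_mono2) (auto simp: small_family_def)
  also have "\<dots> \<le> 2 ^ n * exp (l * ((\<Sum>S\<in>Pow V. f S) / 2 ^ n) + n * (l * c / 2)\<^sup>2)"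
    unfolding n_def by (intro exp_moment_bounded_differences fin diff) (auto simp: l_def c_def)
  also have "\<dots> \<le> 2 ^ n * exp (l * (- n / 4) + n * (l * c / 2)\<^sup>2)"
    using mean by (intro mult_left_mono) (simp_all add: l_def divide_right_mono)
  also have "\<dots> \<le> 2 ^ n * exp (- (n * (1 / 10 ^ 26)) * ln 2)"
  proof -
    have "n * ((1 / 10 ^ 26) * ln 2 + (l * c / 2)\<^sup>2) \<le> n * (l / 4)"
    proof (intro mult_left_mono)
      have "(1 / 10 ^ 26) * ln 2 \<le> (1 / 10 ^ 26) * (1::real)"
        using ln_2_less_1 by (intro mult_left_mono) auto
      then show "(1 / 10 ^ 26) * ln 2 + (l * c / 2)\<^sup>2 \<le> l / 4"
        by (simp add: l_def c_def power2_eq_square)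
    qed simp
    then show ?thesis by (simp add: algebra_simps)
  qed
  also have "\<dots> = 2 powr (n * (1 - 1 / 10 ^ 26))"
    by (simp add: powr_def exp_add[symmetric] exp_diff right_diff_distrib left_diff_distrib
        exp_of_nat_mult[of n "ln 2", simplified] exp_minus field_simps del: exp_add)
  finally show ?thesis by (simp add: n_def)
qed

section \<open>The program and its subroutines\<close>

text \<open>Total correctness with time: \<open>Q\<close> receives the value and the exact number of
  steps. The rules collected in \<open>wp_simps\<close> are equivalences, so \<open>simp\<close>
  runs a body symbolically.\<close>

definition wp :: "program \<Rightarrow> sexp list \<Rightarrow> expr \<Rightarrow> (sexp \<Rightarrow> nat \<Rightarrow> bool) \<Rightarrow> bool" where
  "wp P env e Q \<longleftrightarrow> (\<exists>v t. evaluates P env e v t \<and> Q v t)"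

definition wp_args :: "program \<Rightarrow> sexp list \<Rightarrow> expr list \<Rightarrow> (sexp list \<Rightarrow> nat \<Rightarrow> bool) \<Rightarrow> bool" where
  "wp_args P env es Q \<longleftrightarrow> (\<exists>vs t. evaluates_args P env es vs t \<and> Q vs t)"

text \<open>Left folded by \<open>wp_simps\<close>, so symbolic execution stops at each call, where
  a lemma about the callee or an induction hypothesis takes over.\<close>

definition wp_call :: "program \<Rightarrow> nat \<Rightarrow> sexp list \<Rightarrow> (sexp \<Rightarrow> nat \<Rightarrow> bool) \<Rightarrow> bool" where
  "wp_call P f ws Q \<longleftrightarrow> f < length P \<and> wp P ws (P ! f) Q"

definition computes :: "program \<Rightarrow> nat \<Rightarrow> sexp list \<Rightarrow> sexp \<Rightarrow> nat \<Rightarrow> bool" where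
  "computes P f ws v B \<longleftrightarrow> wp_call P f ws (\<lambda>w t. w = v \<and> t \<le> B)"

lemma wp_VAR: "wp P env (VAR i) Q \<longleftrightarrow> i < length env \<and> Q (env ! i) 1"
  unfolding wp_def by (blast intro: ev_var elim: evaluates.cases[of P env "VAR i"])

lemma wp_NILE: "wp P env NILE Q \<longleftrightarrow> Q NIL 1"
  unfolding wp_def by (blast intro: ev_nil elim: evaluates.cases[of P env NILE])

lemma wp_CONSE: "wp P env (CONSE a b) Q \<longleftrightarrow>
    wp P env a (\<lambda>v t. wp P env b (\<lambda>w u. Q (CONS v w) (t + u + 1)))"
  unfolding wp_def by (blast intro: ev_cons elim: evaluates.cases[of P env "CONSE a b"])

lemma wp_CAR: "wp P env (CAR a) Q \<longleftrightarrow> wp P env a (\<lambda>v t. Q (car v) (t + 1))"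
  unfolding wp_def by (blast intro: ev_car elim: evaluates.cases[of P env "CAR a"])

lemma wp_CDR: "wp P env (CDR a) Q \<longleftrightarrow> wp P env a (\<lambda>v t. Q (cdr v) (t + 1))"
  unfolding wp_def by (blast intro: ev_cdr elim: evaluates.cases[of P env "CDR a"])

lemma wp_IF: "wp P env (IF b x y) Q \<longleftrightarrow>
    wp P env b (\<lambda>w t. if w = NIL then wp P env y (\<lambda>v u. Q v (t + u + 1))
                      else wp P env x (\<lambda>v u. Q v (t + u + 1)))"
proof
  assume "wp P env (IF b x y) Q"
  then obtain v t where ev: "evaluates P env (IF b x y) v t" "Q v t" unfolding wp_def by blast
  from ev(1) show "wp P env b (\<lambda>w t. if w = NIL then wp P env y (\<lambda>v u. Q v (t + u + 1))
                      else wp P env x (\<lambda>v u. Q v (t + u + 1)))"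
    by cases (use ev(2) in \<open>auto simp: wp_def\<close>)
next
  assume "wp P env b (\<lambda>w t. if w = NIL then wp P env y (\<lambda>v u. Q v (t + u + 1))
                      else wp P env x (\<lambda>v u. Q v (t + u + 1)))"
  then obtain w t where w: "evaluates P env b w t"
    "if w = NIL then wp P env y (\<lambda>v u. Q v (t + u + 1)) else wp P env x (\<lambda>v u. Q v (t + u + 1))"
    unfolding wp_def by blast
  show "wp P env (IF b x y) Q"
  proof (cases "w = NIL")
    case True
    then obtain v u where "evaluates P env y v u" "Q v (t + u + 1)"
      using w(2) by (auto simp: wp_def)
    then show ?thesis using w(1) True ev_if_false unfolding wp_def by blast
  next
    case False
    then obtain v u where "evaluates P env x v u" "Q v (t + u + 1)"
      using w(2) by (auto simp: wp_def)
    then show ?thesis using w(1) False ev_if_true unfolding wp_def by blast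
  qed
qed

lemma wp_LET: "wp P env (LET a b) Q \<longleftrightarrow>
    wp P env a (\<lambda>w t. wp P (w # env) b (\<lambda>v u. Q v (t + u + 1)))"
  unfolding wp_def by (blast intro: ev_let elim: evaluates.cases[of P env "LET a b"])

lemma wp_CALL: "wp P env (CALL f es) Q \<longleftrightarrow>
    wp_args P env es (\<lambda>ws t. wp_call P f ws (\<lambda>v u. Q v (t + u + 1)))"
  unfolding wp_def wp_args_def wp_call_def
  by (blast intro: ev_call elim: evaluates.cases[of P env "CALL f es"])

lemma wp_args_Nil: "wp_args P env [] Q \<longleftrightarrow> Q [] 0"
  unfolding wp_args_def by (auto intro: ev_args_Nil elim: evaluates_args.cases)

lemma wp_args_Cons: "wp_args P env (e # es) Q \<longleftrightarrow>
    wp P env e (\<lambda>v t. wp_args P env es (\<lambda>vs u. Q (v # vs) (t + u)))"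
  unfolding wp_def wp_args_def
  by (blast intro: ev_args_Cons elim: evaluates_args.cases[of P env "e # es"])

lemmas wp_simps = wp_VAR wp_NILE wp_CONSE wp_CAR wp_CDR wp_IF wp_LET wp_CALL wp_args_Nil wp_args_Cons

lemma wp_call_computes:
  assumes "computes P f ws v B" and "\<And>t. t \<le> B \<Longrightarrow> Q v t"
  shows "wp_call P f ws Q"
  using assms unfolding computes_def wp_call_def wp_def by blast

lemma computesI:
  assumes "f < length P" "wp P ws (P ! f) (\<lambda>w t. w = v \<and> t \<le> B)"
  shows "computes P f ws v B"
  using assms unfolding computes_def wp_call_def by blast

lemma computes_mono: "computes P f ws v B \<Longrightarrow> B \<le> C \<Longrightarrow> computes P f ws v C"
  unfolding computes_def wp_call_def wp_def by (meson order_trans)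

abbreviation TRUEE :: expr where "TRUEE \<equiv> CONSE NILE NILE"

section \<open>The function bodies of the program\<close>

definition main_body :: expr where
  "main_body = CALL 1 [CAR (VAR 0), CDR (VAR 0), CAR (VAR 0), NILE, NILE]"

text \<open>Arguments: rows of \<open>G\<close>, rows of \<open>G'\<close>, a list whose length is
  the number of undecided vertices, the bits decided so far, and the results collected. The branch
  including the next vertex runs first; its result is the accumulator of the other branch.\<close>

definition enum_body :: expr where
  "enum_body =
    IF (CALL 3 [VAR 3, CALL 2 [VAR 1, VAR 3]])
      (IF (VAR 2)
        (CALL 1 [VAR 0, VAR 1, CDR (VAR 2), CALL 5 [VAR 3, NILE],
           CALL 1 [VAR 0, VAR 1, CDR (VAR 2), CALL 5 [VAR 3, TRUEE], VAR 4]])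
        (IF (CALL 8 [VAR 0, VAR 3])
          (IF (CALL 7 [VAR 0, VAR 3, VAR 0]) (CONSE (CALL 6 [VAR 3, NILE]) (VAR 4)) (VAR 4))
          (VAR 4)))
      (VAR 4)"

text \<open>Yields 5|A| in unary, five cells per sparse vertex; a unary number is at most 2 exactly
  when its second tail is \<open>NIL\<close>.\<close>

definition sparse_body :: expr where
  "sparse_body =
    IF (VAR 0)
      (IF (CDR (CDR (CALL 4 [CAR (VAR 0), VAR 1])))
        (CALL 2 [CDR (VAR 0), VAR 1])
        (CONSE NILE (CONSE NILE (CONSE NILE (CONSE NILE (CONSE NILE (CALL 2 [CDR (VAR 0), VAR 1])))))))
      NILE"

definition le_body :: expr where
  "le_body =
    IF (VAR 0)
      (IF (CAR (VAR 0))
        (IF (VAR 1) (CALL 3 [CDR (VAR 0), CDR (VAR 1)]) NILE)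
        (CALL 3 [CDR (VAR 0), VAR 1]))
      TRUEE"

definition cnt_body :: expr where
  "cnt_body =
    IF (VAR 0)
      (IF (CAR (VAR 0))
        (IF (CAR (VAR 1))
          (CONSE NILE (CALL 4 [CDR (VAR 0), CDR (VAR 1)]))
          (CALL 4 [CDR (VAR 0), CDR (VAR 1)]))
        (CALL 4 [CDR (VAR 0), CDR (VAR 1)]))
      NILE"

definition snoc_body :: expr where
  "snoc_body =
    IF (VAR 0)
      (CONSE (CAR (VAR 0)) (CALL 5 [CDR (VAR 0), VAR 1]))
      (CONSE (VAR 1) NILE)"

definition indices_body :: expr where
  "indices_body =
    IF (VAR 0)
      (IF (CAR (VAR 0))
        (CONSE (VAR 1) (CALL 6 [CDR (VAR 0), CONSE NILE (VAR 1)]))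
        (CALL 6 [CDR (VAR 0), CONSE NILE (VAR 1)]))
      NILE"

text \<open>Argument 2 is a counter, and the vertex tested is the length of its tail. Starting with
  length n it runs through n - 1, ..., 0.\<close>

definition minimal_body :: expr where
  "minimal_body =
    IF (VAR 2)
      (IF (CALL 10 [VAR 1, CDR (VAR 2)])
        (IF (CALL 8 [VAR 0, CALL 9 [VAR 1, CDR (VAR 2)]])
          NILE
          (CALL 7 [VAR 0, VAR 1, CDR (VAR 2)]))
        (CALL 7 [VAR 0, VAR 1, CDR (VAR 2)]))
      TRUEE"

text \<open>Under \<open>LET\<close> the indices shift by one: \<open>VAR 0\<close> is the component
  grown from the first vertex of the set, \<open>VAR 1\<close> the rows, \<open>VAR 2\<close> the
  set. In the first call the last argument uses the rows as a counter of rounds.\<close>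

definition cds_body :: expr where
  "cds_body =
    LET (CALL 13 [VAR 0, VAR 1, CALL 11 [VAR 1], VAR 0])
      (CALL 14 [VAR 1, VAR 2, VAR 0, VAR 0])"

definition remove_body :: expr where
  "remove_body =
    IF (VAR 0)
      (IF (VAR 1)
        (CONSE (CAR (VAR 0)) (CALL 9 [CDR (VAR 0), CDR (VAR 1)]))
        (CONSE NILE (CDR (VAR 0))))
      NILE"

definition bit_body :: expr where
  "bit_body = IF (VAR 1) (CALL 10 [CDR (VAR 0), CDR (VAR 1)]) (CAR (VAR 0))"

definition first_body :: expr where
  "first_body =
    IF (VAR 0)
      (IF (CAR (VAR 0)) (CONSE (CAR (VAR 0)) NILE) (CONSE NILE (CALL 11 [CDR (VAR 0)])))
      NILE"

text \<open>The reached set is passed twice: argument 2 is consumed together with the rows, argument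
  3 stays whole for counting neighbours.\<close>

definition step_body :: expr where
  "step_body =
    IF (VAR 0)
      (CONSE
        (IF (CAR (VAR 2)) TRUEE (IF (CAR (VAR 1)) (CALL 4 [CAR (VAR 0), VAR 3]) NILE))
        (CALL 12 [CDR (VAR 0), CDR (VAR 1), CDR (VAR 2), VAR 3]))
      NILE"

definition close_body :: expr where
  "close_body =
    IF (VAR 3)
      (CALL 13 [VAR 0, VAR 1, CALL 12 [VAR 0, VAR 1, VAR 2, VAR 2], CDR (VAR 3)])
      (VAR 2)"

definition dom_body :: expr where
  "dom_body =
    IF (VAR 0)
      (IF (CAR (VAR 2))
        (CALL 14 [CDR (VAR 0), CDR (VAR 1), CDR (VAR 2), VAR 3])
        (IF (CAR (VAR 1))
          NILE
          (IF (CALL 4 [CAR (VAR 0), VAR 3])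
            (CALL 14 [CDR (VAR 0), CDR (VAR 1), CDR (VAR 2), VAR 3])
            NILE)))
      TRUEE"

definition prog :: program where
  "prog = [main_body, enum_body, sparse_body, le_body, cnt_body, snoc_body, indices_body,
     minimal_body, cds_body, remove_body, bit_body, first_body, step_body, close_body, dom_body]"

lemma prog_length: "length prog = 15"
  by (simp add: prog_def)

lemma prog_nth:
  "prog ! 0 = main_body" "prog ! Suc 0 = enum_body" "prog ! 2 = sparse_body" "prog ! 3 = le_body"
  "prog ! 4 = cnt_body" "prog ! 5 = snoc_body" "prog ! 6 = indices_body" "prog ! 7 = minimal_body"
  "prog ! 8 = cds_body" "prog ! 9 = remove_body" "prog ! 10 = bit_body" "prog ! 11 = first_body"
  "prog ! 12 = step_body" "prog ! 13 = close_body" "prog ! 14 = dom_body"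
  by (simp_all add: prog_def)

section \<open>Bit lists, unary numbers and the subroutines on them\<close>

text \<open>
  Counters are unary: only the length of a list matters, so a list of rows also serves as a loop
  counter and as an index.  Reading past the end of a list yields \<open>NIL\<close>, so a short list stands for
  the same set as its padding by \<open>NIL\<close>.
\<close>

primrec len :: "sexp \<Rightarrow> nat" where
  "len NIL = 0"
| "len (CONS a b) = Suc (len b)"

text \<open>Any entry other than \<open>NIL\<close> counts as set, because \<open>step\<close>
  stores a number of neighbours as a bit.\<close>

primrec bits :: "sexp \<Rightarrow> nat set" where
  "bits NIL = {}"
| "bits (CONS a b) = (if a = NIL then {} else {0}) \<union> Suc ` bits b"

primrec cnt :: "sexp \<Rightarrow> sexp \<Rightarrow> nat" where
  "cnt NIL s = 0"
| "cnt (CONS a b) s = (if a \<noteq> NIL \<and> car s \<noteq> NIL then 1 else 0) + cnt b (cdr s)"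

lemma enc_nat_eq_NIL [simp]: "enc_nat k = NIL \<longleftrightarrow> k = 0"
  by (cases k) auto

lemma cdr_enc_nat [simp]: "cdr (enc_nat k) = enc_nat (k - 1)"
  by (cases k) auto

lemma enc_bool_simps [simp]:
  "enc_bool True = CONS NIL NIL" "enc_bool False = NIL" "enc_bool b = NIL \<longleftrightarrow> \<not> b"
  by (auto simp: enc_bool_def)

text \<open>The simple recursions all get a bound of this shape: 20 covers the cost of one call
  apart from its recursive call.\<close>

lemma computes_cnt: "computes prog 4 [r, s] (enc_nat (cnt r s)) (20 * (len r + 1))"
proof (induction r arbitrary: s)
  case NIL
  show ?case
    by (rule computesI) (auto simp: prog_length prog_nth cnt_body_def wp_simps)
next
  case (CONS a b)
  show ?case
    by (rule computesI)
      (auto simp: prog_length prog_nth cnt_body_def wp_simps intro!: wp_call_computes[OF CONS.IH(2)])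
qed

lemma enc_bool_eq_iff [simp]: "enc_bool a = enc_bool b \<longleftrightarrow> a = b"
  by (auto simp: enc_bool_def)

lemma finite_bits [simp]: "finite (bits s)"
  by (induction s) auto

lemma zero_in_bits [simp]: "0 \<in> bits s \<longleftrightarrow> car s \<noteq> NIL"
  by (cases s) auto

lemma Suc_in_bits [simp]: "Suc i \<in> bits s \<longleftrightarrow> i \<in> bits (cdr s)"
  by (cases s) auto

lemma card_bits_CONS: "card (bits (CONS a b)) = (if a = NIL then 0 else 1) + card (bits b)"
  by (simp add: card_image)

lemma cnt_eq_card: "cnt r s = card (bits r \<inter> bits s)"
proof (induction r arbitrary: s)
  case (CONS a b)
  have "bits (CONS a b) \<inter> bits s =
      (if a \<noteq> NIL \<and> car s \<noteq> NIL then {0} else {}) \<union> Suc ` (bits b \<inter> bits (cdr s))"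
    by auto
  then show ?case using CONS by (simp add: card_image)
qed simp

lemma computes_le: "computes prog 3 [s, enc_nat m] (enc_bool (card (bits s) \<le> m)) (20 * (len s + 1))"
proof (induction s arbitrary: m)
  case NIL
  show ?case
    by (rule computesI) (auto simp: prog_length prog_nth le_body_def wp_simps)
next
  case (CONS a b)
  show ?case
    by (rule computesI)
      (auto simp: prog_length prog_nth le_body_def wp_simps card_bits_CONS simp del: bits.simps(2)
        intro!: wp_call_computes[OF CONS.IH(2)] wp_call_computes[OF CONS.IH(2)[of 0, simplified]])
qed

lemma computes_snoc:
  "computes prog 5 [enc_list enc_bool bs, enc_bool b] (enc_list enc_bool (bs @ [b])) (20 * (length bs + 1))"
proof (induction bs)
  case Nil
  show ?case
    by (rule computesI) (auto simp: prog_length prog_nth snoc_body_def wp_simps)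
next
  case (Cons a bs)
  show ?case
    by (rule computesI)
      (auto simp: prog_length prog_nth snoc_body_def wp_simps intro!: wp_call_computes[OF Cons.IH])
qed

primrec indices :: "bool list \<Rightarrow> nat \<Rightarrow> nat list" where
  "indices [] j = []"
| "indices (b # bs) j = (if b then j # indices bs (Suc j) else indices bs (Suc j))"

lemma computes_indices:
  "computes prog 6 [enc_list enc_bool bs, enc_nat j] (enc_list enc_nat (indices bs j)) (20 * (length bs + 1))"
proof (induction bs arbitrary: j)
  case Nil
  show ?case
    by (rule computesI) (auto simp: prog_length prog_nth indices_body_def wp_simps)
next
  case (Cons a bs)
  show ?case
    by (rule computesI)
      (auto simp: prog_length prog_nth indices_body_def wp_simps
        intro!: wp_call_computes[OF Cons.IH[of "Suc j", simplified]])
qed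

primrec remove_bit :: "sexp \<Rightarrow> sexp \<Rightarrow> sexp" where
  "remove_bit NIL i = NIL"
| "remove_bit (CONS a b) i = (if i = NIL then CONS NIL b else CONS a (remove_bit b (cdr i)))"

lemma len_remove_bit [simp]: "len (remove_bit s i) = len s"
  by (induction s arbitrary: i) auto

lemma bits_remove_bit: "bits (remove_bit s i) = bits s - {len i}"
proof (induction s arbitrary: i)
  case (CONS a b)
  show ?case
  proof (cases i)
    case NIL
    then show ?thesis by auto
  next
    case i: (CONS c d)
    show ?thesis using CONS.IH(2)[of d] by (auto simp: i)
  qed
qed simp

lemma computes_remove_bit: "computes prog 9 [s, i] (remove_bit s i) (20 * (len s + 1))"
proof (induction s arbitrary: i)
  case NIL
  show ?case
    by (rule computesI) (auto simp: prog_length prog_nth remove_body_def wp_simps)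
next
  case (CONS a b)
  show ?case
    by (rule computesI)
      (auto simp: prog_length prog_nth remove_body_def wp_simps
        intro!: wp_call_computes[OF CONS.IH(2)])
qed

primrec nth_bit :: "sexp \<Rightarrow> sexp \<Rightarrow> sexp" where
  "nth_bit NIL s = car s"
| "nth_bit (CONS a b) s = nth_bit b (cdr s)"

lemma nth_bit_eq_NIL [simp]: "nth_bit i s = NIL \<longleftrightarrow> len i \<notin> bits s"
  by (induction i arbitrary: s) auto

lemma computes_nth_bit: "computes prog 10 [s, i] (nth_bit i s) (20 * (len i + 1))"
proof (induction i arbitrary: s)
  case NIL
  show ?case
    by (rule computesI) (auto simp: prog_length prog_nth bit_body_def wp_simps)
next
  case (CONS a b)
  show ?case
    by (rule computesI)
      (auto simp: prog_length prog_nth bit_body_def wp_simps intro!: wp_call_computes[OF CONS.IH(2)])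
qed

text \<open>Picks the start vertex of the component search.\<close>

primrec first_bit :: "sexp \<Rightarrow> sexp" where
  "first_bit NIL = NIL"
| "first_bit (CONS a b) = (if a = NIL then CONS NIL (first_bit b) else CONS a NIL)"

lemma bits_first_bit_empty: "bits s = {} \<Longrightarrow> bits (first_bit s) = {}"
  by (induction s) (auto split: if_splits)

lemma bits_first_bit: "bits s \<noteq> {} \<Longrightarrow> \<exists>x\<in>bits s. bits (first_bit s) = {x}"
proof (induction s)
  case (CONS a b)
  then show ?case by (cases "a = NIL") auto
qed simp

lemma computes_first_bit: "computes prog 11 [s] (first_bit s) (20 * (len s + 1))"
proof (induction s)
  case NIL
  show ?case
    by (rule computesI) (auto simp: prog_length prog_nth first_body_def wp_simps)
next
  case (CONS a b)
  show ?case
    by (rule computesI)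
      (auto simp: prog_length prog_nth first_body_def wp_simps intro!: wp_call_computes[OF CONS.IH(2)])
qed

section \<open>Subroutines on adjacency rows\<close>

abbreviation enc_rows :: "sexp list \<Rightarrow> sexp" where
  "enc_rows \<equiv> enc_list (\<lambda>r. r)"

lemma len_enc_list [simp]: "len (enc_list f xs) = length xs"
  by (induction xs) auto

text \<open>\<open>m\<close> is a strict bound on all lengths, later n + 1, which makes the costs
  uniform in the rows.\<close>

lemma computes_cnt_le: "len r < m \<Longrightarrow> computes prog 4 [r, s] (enc_nat (cnt r s)) (20 * m)"
  by (rule computes_mono[OF computes_cnt]) simp

lemma enc_nat_add_5:
  "enc_nat (5 + k) = CONS NIL (CONS NIL (CONS NIL (CONS NIL (CONS NIL (enc_nat k)))))"
  by (simp add: numeral_eq_Suc)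

lemma computes_sparse:
  assumes "\<forall>r\<in>set rows. len r < m"
  shows "computes prog 2 [enc_rows rows, s] (enc_nat (5 * length (filter (\<lambda>r. cnt r s \<le> 2) rows)))
    ((length rows + 1) * (80 * m + 20))"
  using assms
proof (induction rows)
  case Nil
  show ?case
    by (rule computesI) (auto simp: prog_length prog_nth sparse_body_def wp_simps)
next
  case (Cons r rows)
  then have r: "len r < m" and IH: "computes prog 2 [enc_rows rows, s]
      (enc_nat (5 * length (filter (\<lambda>r. cnt r s \<le> 2) rows))) ((length rows + 1) * (80 * m + 20))"
    by auto
  show ?case
    by (rule computesI)
      (use r in \<open>auto simp: prog_length prog_nth sparse_body_def wp_simps enc_nat_add_5
        intro!: wp_call_computes[OF computes_cnt_le[OF r]] wp_call_computes[OF IH]\<close>)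
qed

text \<open>One round of breadth-first search inside \<open>s\<close>, used with \<open>r\<close>
  and \<open>q\<close> equal.\<close>

primrec step :: "sexp list \<Rightarrow> sexp \<Rightarrow> sexp \<Rightarrow> sexp \<Rightarrow> sexp" where
  "step [] s r q = NIL"
| "step (x # xs) s r q =
     CONS (if car r \<noteq> NIL then CONS NIL NIL else if car s \<noteq> NIL then enc_nat (cnt x q) else NIL)
       (step xs (cdr s) (cdr r) q)"

lemma bits_step:
  "i \<in> bits (step xs s r q) \<longleftrightarrow>
     i < length xs \<and> (i \<in> bits r \<or> i \<in> bits s \<and> bits (xs ! i) \<inter> bits q \<noteq> {})"
proof (induction xs arbitrary: i s r)
  case (Cons x xs)
  then show ?case by (cases i) (auto simp: cnt_eq_card simp del: bits.simps(2))
qed simp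

lemma computes_step:
  assumes "\<forall>x\<in>set xs. len x < m"
  shows "computes prog 12 [enc_rows xs, s, r, q] (step xs s r q) ((length xs + 1) * (80 * m + 20))"
  using assms
proof (induction xs arbitrary: s r)
  case Nil
  show ?case
    by (rule computesI) (auto simp: prog_length prog_nth step_body_def wp_simps)
next
  case (Cons x xs)
  then have x: "len x < m" and IH: "\<And>s r. computes prog 12 [enc_rows xs, s, r, q] (step xs s r q)
      ((length xs + 1) * (80 * m + 20))"
    by auto
  show ?case
    by (rule computesI)
      (use x in \<open>auto simp: prog_length prog_nth step_body_def wp_simps
        intro!: wp_call_computes[OF computes_cnt_le[OF x]] wp_call_computes[OF IH]\<close>)
qed

primrec close :: "sexp \<Rightarrow> sexp list \<Rightarrow> sexp \<Rightarrow> sexp \<Rightarrow> sexp" where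
  "close NIL xs s r = r"
| "close (CONS a b) xs s r = close b xs s (step xs s r r)"

lemma computes_close:
  assumes "\<forall>x\<in>set xs. len x < m"
  shows "computes prog 13 [enc_rows xs, s, r, k] (close k xs s r)
    ((len k + 1) * ((length xs + 1) * (80 * m + 20) + 40))"
proof -
  define B where "B = (length xs + 1) * (80 * m + 20)"
  note step = computes_step[OF assms, folded B_def]
  have "computes prog 13 [enc_rows xs, s, r, k] (close k xs s r) ((len k + 1) * (B + 40))"
  proof (induction k arbitrary: r)
    case NIL
    show ?case
      by (rule computesI) (auto simp: prog_length prog_nth close_body_def wp_simps)
  next
    case (CONS a b)
    show ?case
      by (rule computesI)
        (auto simp: prog_length prog_nth close_body_def wp_simps
          intro!: wp_call_computes[OF step] wp_call_computes[OF CONS.IH(2)])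
  qed
  then show ?thesis by (simp only: B_def)
qed

primrec dominated :: "sexp list \<Rightarrow> sexp \<Rightarrow> sexp \<Rightarrow> sexp \<Rightarrow> bool" where
  "dominated [] s r q = True"
| "dominated (x # xs) s r q \<longleftrightarrow>
     (car r \<noteq> NIL \<or> car s = NIL \<and> cnt x q \<noteq> 0) \<and> dominated xs (cdr s) (cdr r) q"

lemma dominated_iff:
  "dominated xs s r q \<longleftrightarrow>
     (\<forall>i<length xs. i \<in> bits r \<or> i \<notin> bits s \<and> bits (xs ! i) \<inter> bits q \<noteq> {})"
proof (induction xs arbitrary: s r)
  case (Cons x xs)
  then show ?case by (auto simp: cnt_eq_card less_Suc_eq_0_disj all_conj_distrib nth_Cons split: nat.splits)
qed simp

lemma computes_dominated:
  assumes "\<forall>x\<in>set xs. len x < m"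
  shows "computes prog 14 [enc_rows xs, s, r, q] (enc_bool (dominated xs s r q))
    ((length xs + 1) * (80 * m + 20))"
  using assms
proof (induction xs arbitrary: s r)
  case Nil
  show ?case
    by (rule computesI) (auto simp: prog_length prog_nth dom_body_def wp_simps)
next
  case (Cons x xs)
  then have x: "len x < m" and IH: "\<And>s r. computes prog 14 [enc_rows xs, s, r, q]
      (enc_bool (dominated xs s r q)) ((length xs + 1) * (80 * m + 20))"
    by auto
  show ?case
    by (rule computesI)
      (use x in \<open>auto simp: prog_length prog_nth dom_body_def wp_simps
        intro!: wp_call_computes[OF computes_cnt_le[OF x]] wp_call_computes[OF IH]\<close>)
qed

text \<open>Let R be the component of the first element of \<open>s\<close>. The single test that
  each vertex is in R, or is outside \<open>s\<close> with a neighbour in R, says both that R is all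
  of \<open>s\<close> and that \<open>s\<close> dominates.\<close>

definition is_cds :: "sexp list \<Rightarrow> sexp \<Rightarrow> bool" where
  "is_cds xs s = (let r = close (enc_rows xs) xs s (first_bit s) in dominated xs s r r)"

text \<open>Fewer than \<open>m\<close> rounds, each over fewer than \<open>m\<close> rows, at cost
  O(m) per row.\<close>

lemma computes_is_cds:
  assumes "\<forall>x\<in>set xs. len x < m" "length xs < m" "len s < m"
  shows "computes prog 8 [enc_rows xs, s] (enc_bool (is_cds xs s)) (400 * m ^ 3)"
proof -
  define B where "B = (length xs + 1) * (80 * m + 20)"
  have m: "1 \<le> m" "m \<le> m\<^sup>2" "m\<^sup>2 \<le> m ^ 3" "m ^ 2 * m = m ^ 3"
    using assms(2) by (auto simp: power2_eq_square power3_eq_cube)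
  have "B \<le> m * (100 * m)" unfolding B_def using assms(2) by (intro mult_le_mono) auto
  then have B: "B \<le> 100 * m\<^sup>2" by (simp add: power2_eq_square)
  have C: "(length xs + 1) * (B + 40) \<le> 140 * m ^ 3"
  proof -
    have "(length xs + 1) * (B + 40) \<le> m * (140 * m\<^sup>2)"
      using assms(2) B m by (intro mult_le_mono) auto
    then show ?thesis using m by (simp add: mult.commute mult.left_commute)
  qed
  note cl = computes_close[OF assms(1), folded B_def, of s "first_bit s" "enc_rows xs", simplified]
  note dm = computes_dominated[OF assms(1), folded B_def]
  show ?thesis
    by (rule computesI)
      (use B C m assms(3) in \<open>auto simp: prog_length prog_nth cds_body_def wp_simps is_cds_def Let_def
        intro!: wp_call_computes[OF computes_first_bit] wp_call_computes[OF cl] wp_call_computes[OF dm]\<close>)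
qed

primrec no_smaller :: "sexp \<Rightarrow> sexp list \<Rightarrow> sexp \<Rightarrow> bool" where
  "no_smaller NIL xs s = True"
| "no_smaller (CONS a b) xs s \<longleftrightarrow>
     (len b \<in> bits s \<longrightarrow> \<not> is_cds xs (remove_bit s b)) \<and> no_smaller b xs s"

lemma computes_no_smaller:
  assumes "\<forall>x\<in>set xs. len x < m" "length xs < m" "len s < m"
  shows "len k < m \<Longrightarrow>
    computes prog 7 [enc_rows xs, s, k] (enc_bool (no_smaller k xs s)) ((len k + 1) * (500 * m ^ 3))"
proof (induction k)
  case NIL
  have "1 \<le> m ^ 3" using assms(2) by simp
  then have "5 \<le> 500 * m ^ 3" by linarith
  then show ?case
    by (intro computesI) (auto simp: prog_length prog_nth minimal_body_def wp_simps)
next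
  case (CONS a b)
  have m: "1 \<le> m" "m \<le> m ^ 3"
    using assms(2) by (auto simp: power3_eq_cube)
  have r: "len (remove_bit s b) < m" using assms(3) by simp
  have IH: "computes prog 7 [enc_rows xs, s, b] (enc_bool (no_smaller b xs s)) ((len b + 1) * (500 * m ^ 3))"
    using CONS by simp
  show ?case
    by (rule computesI)
      (use m assms(3) CONS.prems in \<open>auto simp: prog_length prog_nth minimal_body_def wp_simps
        intro!: wp_call_computes[OF computes_nth_bit] wp_call_computes[OF computes_remove_bit]
          wp_call_computes[OF computes_is_cds[OF assms(1,2) r]] wp_call_computes[OF IH]\<close>)
qed

section \<open>Correctness of the enumeration\<close>

lemma close_eq_funpow: "close k xs s r = ((\<lambda>r. step xs s r r) ^^ len k) r"
  by (induction k arbitrary: r) (simp_all add: funpow_Suc_right del: funpow.simps(2))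

text \<open>Bridges encodings and sets: a row may have any entries with the right
  \<open>bits\<close>. It is instantiated for both \<open>G\<close> and \<open>G'\<close>.\<close>

locale matrix =
  fixes n :: nat and E :: "nat \<Rightarrow> nat \<Rightarrow> bool" and xs :: "sexp list"
  assumes length_rows: "length xs = n"
    and bits_row: "\<And>i. i < n \<Longrightarrow> bits (xs ! i) = {j. j < n \<and> E i j}"
    and E_sym: "\<And>i j. E i j \<Longrightarrow> E j i"
begin

lemma bits_step_matrix:
  assumes "bits q \<subseteq> {..<n}"
  shows "bits (step xs s r q) = {i. i < n \<and> (i \<in> bits r \<or> i \<in> bits s \<and> (\<exists>j\<in>bits q. E i j))}"
  using assms length_rows by (auto simp: bits_step bits_row) (auto simp: bits_row)

text \<open>Each round keeps a connected subset of \<open>bits s\<close> and either changes nothing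
  or adds a vertex. With at most \<open>n\<close> vertices, \<open>n\<close> rounds reach a fixed
  point, which is closed under neighbours in \<open>bits s\<close>.\<close>

lemma close_component:
  assumes s: "bits s \<subseteq> {..<n}" and x: "x \<in> bits s" "bits r = {x}"
  defines "R \<equiv> bits (close (enc_rows xs) xs s r)"
  shows "R \<subseteq> bits s" "conn E R" "\<And>i j. i \<in> bits s \<Longrightarrow> j \<in> R \<Longrightarrow> E i j \<Longrightarrow> i \<in> R"
proof -
  define F where "F k = bits (((\<lambda>r. step xs s r r) ^^ k) r)" for k
  have F_Suc: "F (Suc k) = {i. i < n \<and> (i \<in> F k \<or> i \<in> bits s \<and> (\<exists>j\<in>F k. E i j))}" if "F k \<subseteq> {..<n}" for k
    using bits_step_matrix[of "((\<lambda>r. step xs s r r) ^^ k) r"] that by (simp add: F_def)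
  have F_sub: "F k \<subseteq> bits s" for k
  proof (induction k)
    case 0
    show ?case using x by (simp add: F_def)
  next
    case (Suc k)
    then show ?case using F_Suc[of k] s by auto
  qed
  have F_mono: "F k \<subseteq> F (Suc k)" for k
    using F_Suc[of k] F_sub[of k] s by auto
  have F_conn: "conn E (F k)" for k
  proof (induction k)
    case 0
    show ?case using x by (auto simp: F_def conn_def)
  next
    case (Suc k)
    show ?case
      by (rule conn_extend[OF E_sym Suc F_mono]) (use F_Suc[of k] F_sub[of k] s in auto)
  qed
  have fin: "finite (F k)" for k using F_sub finite_subset finite_bits by blast
  \<comment> \<open>The start has one vertex, so a search still growing after \<open>k\<close>
    rounds has reached at least \<open>k + 1\<close>. For \<open>k = n\<close> there is no room, and
    stability remains.\<close>
  have grow: "F (Suc k) = F k \<or> card (F k) \<ge> Suc k" for k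
  proof (induction k)
    case 0
    show ?case using x by (simp add: F_def)
  next
    case (Suc k)
    show ?case
    proof (cases "F (Suc k) = F k")
      case True
      then have "F (Suc (Suc k)) = F (Suc k)"
        using F_Suc[of k] F_Suc[of "Suc k"] F_sub[of k] F_sub[of "Suc k"] s by auto
      then show ?thesis by simp
    next
      case False
      then have "F k \<subset> F (Suc k)" using F_mono by blast
      then have "card (F k) < card (F (Suc k))" using fin by (simp add: psubset_card_mono)
      then show ?thesis using Suc False by auto
    qed
  qed
  have R: "R = F n" by (simp add: R_def F_def close_eq_funpow length_rows)
  have "card (F n) \<le> card {..<n}" using F_sub[of n] s by (intro card_mono) auto
  then have stable: "F (Suc n) = F n" using grow[of n] by auto
  show "R \<subseteq> bits s" "conn E R" unfolding R by (rule F_sub, rule F_conn)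
  show "i \<in> R" if "i \<in> bits s" "j \<in> R" "E i j" for i j
    using that stable F_Suc[of n] F_sub[of n] s unfolding R by auto
qed

text \<open>The component found has no edge to the rest of \<open>bits s\<close>, so it is
  everything exactly if \<open>bits s\<close> is connected. For the empty set the test fails at
  vertex 0, which exists by \<open>n > 0\<close>.\<close>

lemma is_cds_iff:
  assumes s: "bits s \<subseteq> {..<n}" and n: "n > 0"
  shows "is_cds xs s \<longleftrightarrow> cds {..<n} E (bits s)"
proof (cases "bits s = {}")
  case True
  have "bits (close k xs s r) = {}" if "bits r = {}" for k r
    using that
  proof (induction k arbitrary: r)
    case (CONS a b)
    have "bits (step xs s r r) = {}" using bits_step_matrix[of r s r] CONS.prems True by auto
    then show ?case using CONS.IH(2) by simp
  qed simp
  then have "\<not> is_cds xs s"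
    using n length_rows bits_first_bit_empty[OF True] by (auto simp: is_cds_def Let_def dominated_iff)
  then show ?thesis using True by (auto simp: cds_def conn_def)
next
  case False
  then obtain x where x: "x \<in> bits s" "bits (first_bit s) = {x}" using bits_first_bit by blast
  define R where "R = bits (close (enc_rows xs) xs s (first_bit s))"
  note R = close_component[OF s x, folded R_def]
  have Rn: "R \<subseteq> {..<n}" using R(1) s by auto
  have D: "is_cds xs s \<longleftrightarrow> (\<forall>i<n. i \<in> R \<or> i \<notin> bits s \<and> (\<exists>j\<in>R. E i j))"
    using Rn by (auto simp: is_cds_def Let_def dominated_iff length_rows R_def[symmetric] bits_row; blast)
  show ?thesis
  proof
    assume c: "is_cds xs s"
    then have "R = bits s" using R(1) s D by auto
    then show "cds {..<n} E (bits s)" using c D R(2) s by (auto simp: cds_def)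
  next
    assume c: "cds {..<n} E (bits s)"
    have "R = bits s"
    proof (rule ccontr)
      assume "R \<noteq> bits s"
      moreover have "R \<noteq> {}" using R(2) by (auto simp: conn_def)
      ultimately obtain a b where "a \<in> R" "b \<in> bits s - R" "E a b"
        using c R(1) unfolding cds_def conn_def by blast
      then show False using R(3)[of b a] E_sym by auto
    qed
    then show "is_cds xs s" using c D by (auto simp: cds_def)
  qed
qed

lemma no_smaller_iff:
  assumes s: "bits s \<subseteq> {..<n}" and n: "n > 0"
  shows "no_smaller k xs s \<longleftrightarrow> (\<forall>i\<in>bits s. i < len k \<longrightarrow> \<not> cds {..<n} E (bits s - {i}))"
proof (induction k)
  case (CONS a b)
  have "is_cds xs (remove_bit s b) \<longleftrightarrow> cds {..<n} E (bits s - {len b})"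
    using is_cds_iff[of "remove_bit s b"] s n by (auto simp: bits_remove_bit)
  then show ?case using CONS.IH(2) by (auto simp: less_Suc_eq)
qed simp

lemma minimal_connected_computed:
  assumes s: "bits s \<subseteq> {..<n}" and n: "n > 0"
  shows "is_cds xs s \<and> no_smaller (enc_rows xs) xs s \<longleftrightarrow> minimal_connected {..<n} E (bits s)"
  unfolding is_cds_iff[OF s n] no_smaller_iff[OF s n] minimal_connected_def
  using s length_rows by auto

lemma small_family_computed:
  assumes s: "bits s \<subseteq> {..<n}"
  shows "card (bits s) \<le> 5 * length (filter (\<lambda>r. cnt r s \<le> 2) xs) \<longleftrightarrow> bits s \<in> small_family {..<n} E"
proof -
  have "cnt (xs ! i) s = deg E (bits s) i" if "i < n" for i
  proof -
    have "bits (xs ! i) \<inter> bits s = {y \<in> bits s. E i y}" using that s by (auto simp: bits_row)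
    then show ?thesis by (simp add: cnt_eq_card deg_def)
  qed
  then have "{i. i < length xs \<and> cnt (xs ! i) s \<le> 2} = sparse {..<n} E (bits s)"
    by (auto simp: sparse_def length_rows)
  then show ?thesis using s by (simp add: length_filter_conv_card small_family_def)
qed

end

section \<open>The pruned search tree: its leaves and its number of nodes\<close>

primrec leaves :: "(bool list \<Rightarrow> bool) \<Rightarrow> (bool list \<Rightarrow> bool) \<Rightarrow> nat \<Rightarrow> bool list \<Rightarrow> bool list list" where
  "leaves small good 0 bs = (if small bs \<and> good bs then [bs] else [])"
| "leaves small good (Suc k) bs =
     (if small bs then leaves small good k (bs @ [False]) @ leaves small good k (bs @ [True]) else [])"

text \<open>Number of calls of the enumeration function below the prefix \<open>bs\<close>; a prefix
  failing the test still costs one call.\<close>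

primrec calls :: "(bool list \<Rightarrow> bool) \<Rightarrow> nat \<Rightarrow> bool list \<Rightarrow> nat" where
  "calls small 0 bs = 1"
| "calls small (Suc k) bs =
     (if small bs then 1 + calls small k (bs @ [True]) + calls small k (bs @ [False]) else 1)"

abbreviation enc_bits :: "bool list \<Rightarrow> sexp" where
  "enc_bits \<equiv> enc_list enc_bool"

abbreviation enc_sets :: "nat list list \<Rightarrow> sexp" where
  "enc_sets \<equiv> enc_list (enc_list enc_nat)"

definition small_bits :: "sexp list \<Rightarrow> bool list \<Rightarrow> bool" where
  "small_bits ys bs \<longleftrightarrow>
     card (bits (enc_bits bs)) \<le> 5 * length (filter (\<lambda>r. cnt r (enc_bits bs) \<le> 2) ys)"

definition good_bits :: "sexp list \<Rightarrow> bool list \<Rightarrow> bool" where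
  "good_bits xs bs \<longleftrightarrow> is_cds xs (enc_bits bs) \<and> no_smaller (enc_rows xs) xs (enc_bits bs)"

text \<open>The cost per node is dominated by the minimality test at a leaf: fewer than
  \<open>m\<close> tests of cost O(m^3). The accumulator is threaded through both branches, so the
  results below a node end up in front of \<open>acc\<close>.\<close>

lemma computes_enum:
  assumes xs: "\<forall>x\<in>set xs. len x < m" "length xs < m"
    and ys: "\<forall>y\<in>set ys. len y < m" "length ys < m"
  shows "len k + length bs < m \<Longrightarrow>
    computes prog 1 [enc_rows xs, enc_rows ys, k, enc_bits bs, enc_sets acc]
      (enc_sets (map (\<lambda>c. indices c 0) (leaves (small_bits ys) (good_bits xs) (len k) bs) @ acc))
      (calls (small_bits ys) (len k) bs * (2000 * m ^ 4))"
proof (induction k arbitrary: bs acc)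
  case NIL
  then have bs: "len (enc_bits bs) < m" "length bs < m" by auto
  have m: "1 \<le> m" "m \<le> m\<^sup>2" "m\<^sup>2 \<le> m ^ 4" "m ^ 3 \<le> m ^ 4" "m * m ^ 3 = m ^ 4"
    using xs(2) by (auto intro!: power_increasing simp: power_eq_if)
  have "(length ys + 1) * (80 * m + 20) \<le> m * (100 * m)"
    using ys(2) by (intro mult_le_mono) auto
  then have "(length ys + 1) * (80 * m + 20) \<le> 100 * m ^ 4"
    using m by (simp add: power2_eq_square)
  note sp = computes_mono[OF computes_sparse[OF ys(1)] this]
  have "(length xs + 1) * (500 * m ^ 3) \<le> m * (500 * m ^ 3)"
    using xs(2) by (intro mult_le_mono) auto
  then have "(length xs + 1) * (500 * m ^ 3) \<le> 500 * m ^ 4"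
    using m by simp
  note ns = computes_mono[OF computes_no_smaller[OF xs bs(1), of "enc_rows xs", simplified, OF xs(2)] this[simplified]]
  note ind = computes_indices[of bs 0, simplified]
  show ?case
    by (rule computesI)
      (use m bs in \<open>auto simp: prog_length prog_nth enum_body_def wp_simps small_bits_def good_bits_def
        intro!: wp_call_computes[OF computes_le] wp_call_computes[OF sp]
          wp_call_computes[OF computes_is_cds[OF xs bs(1)]] wp_call_computes[OF ns]
          wp_call_computes[OF ind]\<close>)
next
  case (CONS a b)
  then have bs: "len (enc_bits bs) < m" "length bs < m" by auto
  have m: "1 \<le> m" "m \<le> m\<^sup>2" "m\<^sup>2 \<le> m ^ 4" "m ^ 3 \<le> m ^ 4" "m * m ^ 3 = m ^ 4"
    using xs(2) by (auto intro!: power_increasing simp: power_eq_if)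
  have "(length ys + 1) * (80 * m + 20) \<le> m * (100 * m)"
    using ys(2) by (intro mult_le_mono) auto
  then have "(length ys + 1) * (80 * m + 20) \<le> 100 * m ^ 4"
    using m by (simp add: power2_eq_square)
  note sp = computes_mono[OF computes_sparse[OF ys(1)] this]
  note sn = computes_snoc[of bs True, simplified] computes_snoc[of bs False, simplified]
  have IH: "computes prog (Suc 0) [enc_rows xs, enc_rows ys, b, enc_bits (bs @ [c]), enc_sets acc]
      (enc_sets (map (\<lambda>c. indices c 0) (leaves (small_bits ys) (good_bits xs) (len b) (bs @ [c])) @ acc))
      (calls (small_bits ys) (len b) (bs @ [c]) * (2000 * m ^ 4))" for c acc
    using CONS by simp
  show ?case
    by (rule computesI)
      (use m bs in \<open>auto simp: prog_length prog_nth enum_body_def wp_simps small_bits_def[symmetric]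
          add_mult_distrib
        intro!: wp_call_computes[OF computes_le] wp_call_computes[OF sp]
          wp_call_computes[OF sn(1)] wp_call_computes[OF sn(2)]
          wp_call_computes[OF IH]\<close>)
qed

lemma take_leaves: "c \<in> set (leaves small good k bs) \<Longrightarrow> take (length bs) c = bs"
proof (induction k arbitrary: bs)
  case (Suc k)
  then obtain b where "c \<in> set (leaves small good k (bs @ [b]))" by (auto split: if_splits)
  then have "take (length (bs @ [b])) c = bs @ [b]" by (rule Suc.IH)
  then have "take (length bs) (take (length (bs @ [b])) c) = bs" by simp
  then show ?case by simp
qed (auto split: if_splits)

text \<open>Leaves of the two branches differ at position \<open>length bs\<close>.\<close>

lemma distinct_leaves: "distinct (leaves small good k bs)"
proof (induction k arbitrary: bs)
  case (Suc k)
  have "set (leaves small good k (bs @ [False])) \<inter> set (leaves small good k (bs @ [True])) = {}"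
    using take_leaves[of _ small good k "bs @ [False]"] take_leaves[of _ small good k "bs @ [True]"]
    by fastforce
  then show ?case using Suc by simp
qed simp

lemma take_length_eq_iff:
  assumes "length bs < length c"
  shows "take (length bs) c = bs \<longleftrightarrow>
    take (Suc (length bs)) c = bs @ [False] \<or> take (Suc (length bs)) c = bs @ [True]"
  using assms by (cases "c ! length bs") (auto simp: take_Suc_conv_app_nth)

text \<open>Pruning loses nothing, since by assumption all prefixes of a good string pass the
  test.\<close>

lemma set_leaves:
  assumes "\<And>c j. length c = N \<Longrightarrow> good c \<Longrightarrow> small (take j c)"
  shows "length bs + k = N \<Longrightarrow>
    set (leaves small good k bs) = {c. length c = N \<and> take (length bs) c = bs \<and> good c}"
proof (induction k arbitrary: bs)
  case 0
  then show ?case using assms[of bs "length bs"] by auto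
next
  case (Suc k)
  have "set (leaves small good k (bs @ [b])) = {c. length c = N \<and> take (Suc (length bs)) c = bs @ [b] \<and> good c}" for b
    using Suc.IH[of "bs @ [b]"] Suc.prems by simp
  moreover have "small bs" if "length c = N" "take (length bs) c = bs" "good c" for c
    using assms[of c "length bs"] that by simp
  moreover have "take (length bs) c = bs \<longleftrightarrow>
    take (Suc (length bs)) c = bs @ [False] \<or> take (Suc (length bs)) c = bs @ [True]" if "length c = N" for c
    using take_length_eq_iff[of bs c] that Suc.prems by simp
  ultimately show ?case by auto
qed

text \<open>A node that passes has a passing full string below it, its padding by
  \<open>False\<close>. If w \<ge> 1 such strings are split between the two children, these cost at
  most 2 + 2kw calls, and 3 + 2kw \<le> 1 + 2(k + 1)w.\<close>

lemma calls_le: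
  assumes "\<And>bs k. small bs \<Longrightarrow> small (bs @ replicate k False)"
  shows "calls small k bs \<le>
    1 + 2 * k * card {c. length c = length bs + k \<and> take (length bs) c = bs \<and> small c}"
proof (induction k arbitrary: bs)
  case (Suc k)
  define W where "W j bs = {c. length c = length bs + j \<and> take (length bs) c = bs \<and> small c}" for j bs
  have fin: "finite (W j bs)" for j bs
    by (rule finite_subset[OF _ finite_lists_length_eq[of "UNIV :: bool set" "length bs + j"]])
      (auto simp: W_def)
  show ?case
  proof (cases "small bs")
    case True
    have "W (Suc k) bs = W k (bs @ [False]) \<union> W k (bs @ [True])"
    proof (rule set_eqI)
      fix c
      show "c \<in> W (Suc k) bs \<longleftrightarrow> c \<in> W k (bs @ [False]) \<union> W k (bs @ [True])"
        using take_length_eq_iff[of bs c] by (auto simp: W_def)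
    qed
    moreover have "W k (bs @ [False]) \<inter> W k (bs @ [True]) = {}" by (auto simp: W_def)
    ultimately have card: "card (W (Suc k) bs) = card (W k (bs @ [False])) + card (W k (bs @ [True]))"
      using fin by (simp add: card_Un_disjoint)
    have "bs @ replicate (Suc k) False \<in> W (Suc k) bs" using assms[OF True, of "Suc k"] by (simp add: W_def)
    then have "card (W (Suc k) bs) \<ge> 1" using fin by (metis One_nat_def Suc_leI card_gt_0_iff empty_iff)
    moreover have "calls small k (bs @ [b]) \<le> 1 + 2 * k * card (W k (bs @ [b]))" for b
      using Suc.IH[of "bs @ [b]"] by (simp add: W_def)
    from this[of True] this[of False]
    have "calls small (Suc k) bs \<le> 3 + 2 * k * card (W (Suc k) bs)"
      using True by (simp add: card algebra_simps)
    ultimately have "calls small (Suc k) bs \<le> 1 + 2 * Suc k * card (W (Suc k) bs)" by simp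
    then show ?thesis by (simp add: W_def)
  qed simp
qed simp

section \<open>Bit lists as subsets of an initial segment, and correctness of the program\<close>

lemma bits_enc_bits: "bits (enc_bits bs) = {i. i < length bs \<and> bs ! i}"
proof (induction bs)
  case (Cons b bs)
  show ?case
  proof (rule set_eqI)
    fix i
    show "i \<in> bits (enc_bits (b # bs)) \<longleftrightarrow> i \<in> {i. i < length (b # bs) \<and> (b # bs) ! i}"
      using Cons by (cases i) (auto simp del: bits.simps(2))
  qed
qed simp

lemma set_indices: "set (indices bs j) = (+) j ` bits (enc_bits bs)"
proof (induction bs arbitrary: j)
  case (Cons b bs)
  show ?case by (simp add: Cons image_Un image_image)
qed simp

lemma distinct_indices: "distinct (indices bs j)"
  by (induction bs arbitrary: j) (auto simp: set_indices)

lemma bits_enc_bits_inj: "length bs = length cs \<Longrightarrow> bits (enc_bits bs) = bits (enc_bits cs) \<Longrightarrow> bs = cs"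
  by (rule nth_equalityI) (auto simp: bits_enc_bits set_eq_iff)

lemma bits_enc_bits_surj:
  assumes "S \<subseteq> {..<n}"
  shows "\<exists>bs. length bs = n \<and> bits (enc_bits bs) = S"
  by (rule exI[of _ "map (\<lambda>i. i \<in> S) [0..<n]"]) (use assms in \<open>auto simp: bits_enc_bits\<close>)

lemma runs_prog:
  assumes xs: "matrix n E xs" "\<forall>x\<in>set xs. len x \<le> n"
    and ys: "matrix n E' ys" "\<forall>y\<in>set ys. len y \<le> n" and n: "n > 0"
    and small: "\<And>S. minimal_connected {..<n} E S \<Longrightarrow> S \<in> small_family {..<n} E'"
  shows "\<exists>y t. runs prog (CONS (enc_rows xs) (enc_rows ys)) y t \<and>
    lists_family y {S. minimal_connected {..<n} E S} \<and>
    t \<le> (1 + 2 * n * card (small_family {..<n} E')) * (2000 * (n + 1) ^ 4) + 20"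
proof -
  interpret X: matrix n E xs by fact
  interpret Y: matrix n E' ys by fact
  define sm where "sm = small_bits ys"
  define gd where "gd = good_bits xs"
  have sub: "bits (enc_bits bs) \<subseteq> {..<n}" if "length bs \<le> n" for bs
    using that by (auto simp: bits_enc_bits)
  have sm: "sm bs \<longleftrightarrow> bits (enc_bits bs) \<in> small_family {..<n} E'" if "length bs \<le> n" for bs
    unfolding sm_def small_bits_def using Y.small_family_computed[OF sub[OF that]] .
  have gd: "gd bs \<longleftrightarrow> minimal_connected {..<n} E (bits (enc_bits bs))" if "length bs \<le> n" for bs
    unfolding gd_def good_bits_def using X.minimal_connected_computed[OF sub[OF that] n] .
  define ls where "ls = leaves sm gd n []"
  define sets where "sets = map (\<lambda>c. indices c 0) ls"
  have "computes prog 1 [enc_rows xs, enc_rows ys, enc_rows xs, NIL, NIL] (enc_sets sets)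
      (calls sm n [] * (2000 * (n + 1) ^ 4))"
    using computes_enum[of xs "n + 1" ys "enc_rows xs" "[]" "[]"] xs ys X.length_rows Y.length_rows
    by (simp add: sets_def ls_def sm_def gd_def less_Suc_eq_le)
  \<comment> \<open>The 20 extra steps cover the entry call and \<open>main_body\<close>.\<close>
  then have "wp prog [CONS (enc_rows xs) (enc_rows ys)] (CALL 0 [VAR 0])
      (\<lambda>y t. y = enc_sets sets \<and> t \<le> calls sm n [] * (2000 * (n + 1) ^ 4) + 20)"
    by (auto simp: wp_simps wp_call_def[of _ 0] prog_length prog_nth main_body_def intro!: wp_call_computes)
  then obtain t where t: "runs prog (CONS (enc_rows xs) (enc_rows ys)) (enc_sets sets) t"
    "t \<le> calls sm n [] * (2000 * (n + 1) ^ 4) + 20"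
    unfolding wp_def runs_def by blast
  have take_sub: "bits (enc_bits (take j c)) \<subseteq> bits (enc_bits c)" for j c
    by (auto simp: bits_enc_bits)
  have ls: "set ls = {c. length c = n \<and> gd c}"
  proof -
    \<comment> \<open>A prefix stands for a subset of the whole set, and the family is closed under
      subsets; so no minimal set is pruned.\<close>
    have "sm (take j c)" if "length c = n" "gd c" for j c
      using that small small_family_subset_closed[OF _ _ take_sub] by (simp add: gd sm)
    then show ?thesis using set_leaves[of n gd sm "[]" n] by (simp add: ls_def)
  qed
  have set_ind: "set (indices c 0) = bits (enc_bits c)" for c by (simp add: set_indices)
  have "distinct (map set sets)"
  proof -
    have "inj_on (\<lambda>c. bits (enc_bits c)) (set ls)"
      by (rule inj_onI, rule bits_enc_bits_inj) (auto simp: ls)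
    then show ?thesis
      using distinct_leaves[of sm gd n "[]"]
      by (simp add: sets_def distinct_map comp_def set_ind flip: ls_def)
  qed
  moreover have "set (map set sets) = {S. minimal_connected {..<n} E S}"
  proof -
    have "set (map set sets) = (\<lambda>c. bits (enc_bits c)) ` {c. length c = n \<and> gd c}"
      by (simp add: sets_def image_image set_ind ls)
    also have "\<dots> = {S. minimal_connected {..<n} E S}"
    proof (intro equalityI subsetI)
      fix S assume "S \<in> {S. minimal_connected {..<n} E S}"
      then have S: "minimal_connected {..<n} E S" by simp
      then have "S \<subseteq> {..<n}" by (auto simp: minimal_connected_def cds_def)
      then obtain bs where "length bs = n" "bits (enc_bits bs) = S" using bits_enc_bits_surj by blast
      then show "S \<in> (\<lambda>c. bits (enc_bits c)) ` {c. length c = n \<and> gd c}" using S by (force simp: gd)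
    qed (auto simp: gd)
    finally show ?thesis .
  qed
  moreover have "\<forall>zs\<in>set sets. distinct zs" by (auto simp: sets_def distinct_indices)
  ultimately have fam: "lists_family (enc_sets sets) {S. minimal_connected {..<n} E S}"
    unfolding lists_family_def by blast
  have "calls sm n [] \<le> 1 + 2 * n * card {c. length c = n \<and> sm c}"
  proof -
    \<comment> \<open>Padding by \<open>False\<close> adds no bit, and \<open>small_bits\<close>
      depends only on the bits.\<close>
    have "sm (bs @ replicate k False)" if "sm bs" for bs k
    proof -
      have "bits (enc_bits (bs @ replicate k False)) = bits (enc_bits bs)"
      proof (rule set_eqI)
        fix i
        show "i \<in> bits (enc_bits (bs @ replicate k False)) \<longleftrightarrow> i \<in> bits (enc_bits bs)"
          by (cases "i < length bs") (auto simp: bits_enc_bits nth_append)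
      qed
      moreover have "cnt r (enc_bits (bs @ replicate k False)) = cnt r (enc_bits bs)" for r
        by (simp add: cnt_eq_card calculation)
      ultimately show ?thesis using that by (simp add: sm_def small_bits_def)
    qed
    then show ?thesis using calls_le[of sm n "[]"] by simp
  qed
  also have "card {c. length c = n \<and> sm c} \<le> card (small_family {..<n} E')"
  proof (rule card_inj_on_le)
    show "inj_on (\<lambda>c. bits (enc_bits c)) {c. length c = n \<and> sm c}"
      by (rule inj_onI, rule bits_enc_bits_inj) auto
    show "finite (small_family {..<n} E')" by (simp add: small_family_def)
  qed (auto simp: sm)
  finally have "calls sm n [] \<le> 1 + 2 * n * card (small_family {..<n} E')" by simp
  then have "calls sm n [] * (2000 * (n + 1) ^ 4) + 20 \<le>
      (1 + 2 * n * card (small_family {..<n} E')) * (2000 * (n + 1) ^ 4) + 20"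
    by (intro add_mono mult_le_mono) auto
  then show ?thesis using t fam by (meson order_trans)
qed

section \<open>Digraphs of the library\<close>

lemma dominates_sym: "graph G \<Longrightarrow> x \<rightarrow>\<^bsub>G\<^esub> y \<Longrightarrow> y \<rightarrow>\<^bsub>G\<^esub> x"
  using sym_digraph.sym_arcs[of G] by (auto simp: graph_def pseudo_graph_def symmetric_def dest: symD)

lemma dominates_irrefl: "graph G \<Longrightarrow> \<not> x \<rightarrow>\<^bsub>G\<^esub> x"
  using loopfree_digraph.no_loops[of G] by (auto simp: graph_def digraph_def arcs_ends_conv)

text \<open>The library counts arcs. Without parallel arcs, \<open>head\<close> maps the arcs
  leaving \<open>v\<close> injectively onto its neighbours.\<close>

lemma out_degree_eq_deg:
  assumes "graph G"
  shows "out_degree G v = deg (dominates G) (verts G) v"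
proof -
  interpret graph G by fact
  have "inj_on (head G) (out_arcs G v)"
    by (rule inj_onI) (auto intro!: no_multi_arcs simp: arc_to_ends_def)
  moreover have "head G ` out_arcs G v = {y \<in> verts G. v \<rightarrow>\<^bsub>G\<^esub> y}"
    by (auto simp: arcs_ends_conv)
  ultimately show ?thesis
    unfolding out_degree_def deg_def by (metis card_image)
qed

text \<open>A path cannot leave a set without outgoing arcs, so reachability of all pairs excludes
  such cuts. Conversely, the set reachable from \<open>u\<close> has no outgoing arc and hence is
  all of \<open>S\<close>.\<close>

lemma connected_induce_iff:
  assumes "graph G"
  shows "Digraph_Component.connected (G \<restriction> S) \<longleftrightarrow> conn (dominates G) S"
proof -
  define r where "r = {(a, b). a \<in> S \<and> b \<in> S \<and> a \<rightarrow>\<^bsub>G\<^esub> b}"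
  have "arcs_ends (G \<restriction> S) = r" by (auto simp: arcs_ends_conv r_def induce_subgraph_def)
  moreover have "r\<^sup>s = r" using dominates_sym[OF assms] by (auto simp: symcl_def r_def)
  ultimately have C: "Digraph_Component.connected (G \<restriction> S) \<longleftrightarrow>
      S \<noteq> {} \<and> (\<forall>u\<in>S. \<forall>v\<in>S. (u, v) \<in> rtrancl_on S r)"
    by (simp add: connected_conv)
  show ?thesis
  proof
    assume c: "Digraph_Component.connected (G \<restriction> S)"
    show "conn (dominates G) S"
      unfolding conn_def
    proof (intro conjI allI impI)
      show "S \<noteq> {}" using c C by blast
      fix A assume A: "A \<subseteq> S \<and> A \<noteq> {} \<and> A \<noteq> S"
      show "\<exists>a\<in>A. \<exists>b\<in>S - A. a \<rightarrow>\<^bsub>G\<^esub> b"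
      proof (rule ccontr)
        assume no: "\<not> (\<exists>a\<in>A. \<exists>b\<in>S - A. a \<rightarrow>\<^bsub>G\<^esub> b)"
        obtain a b where ab: "a \<in> A" "b \<in> S - A" using A by blast
        then have "(a, b) \<in> rtrancl_on S r" using c C A by blast
        then have "b \<in> A"
        proof (induction rule: rtrancl_on_induct)
          case base
          show ?case by (rule ab(1))
        next
          case (step y z)
          then show ?case using no by (auto simp: r_def)
        qed
        then show False using ab by blast
      qed
    qed
  next
    assume c: "conn (dominates G) S"
    have "(u, v) \<in> rtrancl_on S r" if uv: "u \<in> S" "v \<in> S" for u v
    proof (rule ccontr)
      define A where "A = {w \<in> S. (u, w) \<in> rtrancl_on S r}"
      assume "(u, v) \<notin> rtrancl_on S r"
      then have "A \<subseteq> S" "u \<in> A" "A \<noteq> S" using uv by (auto simp: A_def intro: rtrancl_on.intros)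
      then obtain a b where "a \<in> A" "b \<in> S - A" "a \<rightarrow>\<^bsub>G\<^esub> b"
        using c unfolding conn_def by blast
      then show False by (auto simp: A_def r_def intro: rtrancl_on.intros)
    qed
    then show "Digraph_Component.connected (G \<restriction> S)" using c C by (auto simp: conn_def)
  qed
qed

lemma minimal_cds_iff:
  assumes "graph G"
  shows "minimal_cds G S \<longleftrightarrow> minimal_connected (verts G) (dominates G) S"
proof -
  have "connected_dominating_set G T \<longleftrightarrow> cds (verts G) (dominates G) T" for T
    by (simp add: connected_dominating_set_def dominating_set_def cds_def
        connected_induce_iff[OF assms])
  then show ?thesis
    by (simp only: minimal_cds_def minimal_connected_iff[of "dominates G", OF dominates_sym[OF assms]])
qed

lemma spanning_dominates: "spanning G' G \<Longrightarrow> x \<rightarrow>\<^bsub>G'\<^esub> y \<Longrightarrow> x \<rightarrow>\<^bsub>G\<^esub> y"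
  by (auto simp: spanning_def subgraph_def compatible_def arcs_ends_conv)

lemma minimal_connected_in_small_family:
  assumes "graph G" "spanning G' G" "minimal_connected (verts G) (dominates G) S"
  shows "S \<in> small_family (verts G) (dominates G')"
proof -
  interpret graph G by fact
  have "card S \<le> 5 * card (sparse (verts G) (dominates G') S)"
    by (rule cds_card_le_sparse[of "dominates G"])
      (use assms in \<open>auto simp: minimal_connected_def intro: dominates_sym spanning_dominates
        dest: dominates_irrefl\<close>)
  then show ?thesis using assms(3) by (auto simp: small_family_def minimal_connected_def cds_def)
qed

lemma card_small_family_graph_le:
  assumes "graph G'" "degree_conditions G'"
  shows "real (card (small_family (verts G') (dominates G'))) \<le>
    2 powr (card (verts G') * (1 - 1 / 10 ^ 26))"
proof -
  interpret graph G' by fact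
  show ?thesis
    by (rule card_small_family_le)
      (use assms in \<open>auto simp: degree_conditions_def out_degree_eq_deg[OF assms(1)]
        intro: dominates_sym\<close>)
qed

text \<open>Fewer than n/60 low-degree vertices leave some vertex with 14 neighbours. This excludes
  n = 0 and lets powers of n absorb constants in the running time.\<close>

lemma degree_conditions_card_ge:
  assumes "graph G" "degree_conditions G"
  shows "card (verts G) \<ge> 14"
proof -
  interpret graph G by fact
  have c: "real (card {v \<in> verts G. out_degree G v < 14}) < 1 / 60 * card (verts G)"
    using assms(2) by (simp add: degree_conditions_def)
  have "{v \<in> verts G. out_degree G v < 14} \<noteq> verts G"
  proof
    assume "{v \<in> verts G. out_degree G v < 14} = verts G"
    then show False using c by simp
  qed
  then obtain v where "v \<in> verts G" "out_degree G v \<ge> 14" using not_less by blast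
  moreover have "deg (dominates G) (verts G) v \<le> card (verts G)"
    unfolding deg_def by (intro card_mono) auto
  ultimately show ?thesis by (simp add: out_degree_eq_deg[OF assms(1)])
qed

lemma enc_graph_matrix:
  fixes G :: "(nat, 'b) pre_digraph"
  assumes "graph G"
  shows "\<exists>xs. enc_graph n G = enc_rows xs \<and> matrix n (dominates G) xs \<and> (\<forall>x\<in>set xs. len x \<le> n)"
proof -
  define row where "row u = enc_list (\<lambda>v. enc_bool (u \<rightarrow>\<^bsub>G\<^esub> v)) [0..<n]" for u
  have enc_map: "enc_list f zs = enc_list g (map h zs)" if "\<And>z. f z = g (h z)"
    for f :: "nat \<Rightarrow> sexp" and g :: "'c \<Rightarrow> sexp" and h zs
    by (induction zs) (simp_all add: that)
  have "row u = enc_bits (map (\<lambda>v. u \<rightarrow>\<^bsub>G\<^esub> v) [0..<n])" for u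
    unfolding row_def by (rule enc_map) simp
  then have "bits (row u) = {j. j < n \<and> u \<rightarrow>\<^bsub>G\<^esub> j}" for u
    by (auto simp: bits_enc_bits)
  then have "matrix n (dominates G) (map row [0..<n])"
    by unfold_locales (auto intro: dominates_sym[OF assms])
  moreover have "enc_graph n G = enc_rows (map row [0..<n])"
    unfolding enc_graph_def by (rule enc_map) (simp add: row_def)
  moreover have "\<forall>x\<in>set (map row [0..<n]). len x \<le> n" by (auto simp: row_def)
  ultimately show ?thesis by blast
qed

section \<open>Running time and conclusion\<close>

lemma running_time_arith:
  fixes W :: real
  assumes n: "n \<ge> 14" and F: "real F \<le> W" and W: "W \<ge> 1"
    and t: "t \<le> (1 + 2 * n * F) * (2000 * (n + 1) ^ 4) + 20"
  shows "real t \<le> W * real n ^ 10"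
proof -
  define x where "x = real n"
  have x: "x \<ge> 14" using n by (simp add: x_def)
  have "real t \<le> (1 + 2 * x * real F) * (2000 * (x + 1) ^ 4) + 20"
    using of_nat_mono[OF t, where 'a = real] by (simp add: x_def algebra_simps)
  also have "\<dots> \<le> (1 + 2 * x * W) * (2000 * (x + 1) ^ 4) + 20"
    using F x by (intro add_mono mult_right_mono mult_left_mono) auto
  also have "\<dots> \<le> (3 * x * W) * (2000 * (2 * x) ^ 4) + W * x ^ 5"
  proof (intro add_mono mult_mono)
    have "1 * 1 \<le> x * W" using x W by (intro mult_mono) auto
    then show "1 + 2 * x * W \<le> 3 * x * W" by (simp add: mult.commute)
    show "(x + 1) ^ 4 \<le> (2 * x) ^ 4" using x by (intro power_mono) auto
    have "1 * (14::real) ^ 5 \<le> W * x ^ 5" using x W by (intro mult_mono power_mono) auto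
    then show "20 \<le> W * x ^ 5" by simp
  qed (use x W in auto)
  \<comment> \<open>3 * 2000 * 2^4 = 96000, and the additive 20 accounts for one more. The next step
    absorbs 96001 into x^5, as 14^5 = 537824.\<close>
  also have "\<dots> = 96001 * (W * x ^ 5)" by (simp add: power_mult_distrib power_eq_if)
  also have "\<dots> \<le> x ^ 5 * (W * x ^ 5)"
  proof (intro mult_right_mono)
    have "(14::real) ^ 5 \<le> x ^ 5" using x by (intro power_mono) auto
    then show "96001 \<le> x ^ 5" by simp
  qed (use x W in auto)
  also have "\<dots> = W * x ^ 10" by (simp add: power_eq_if)
  finally show ?thesis by (simp add: x_def)
qed

theorem lemma5:
  shows "(\<exists>C :: real. \<forall>(G :: ('a, 'b) pre_digraph) (G' :: ('a, 'b) pre_digraph) n.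
            graph G \<and> card (verts G) = n \<and>
            graph G' \<and> spanning G' G \<and> degree_conditions G' \<longrightarrow>
            real (card {S. minimal_cds G S}) \<le> C * 2 powr (real n * (1 - 1 / 10 ^ 26)))
       \<and> (\<exists>(P :: program) (k :: nat).
            \<forall>(G :: (nat, nat \<times> nat) pre_digraph) (G' :: (nat, nat \<times> nat) pre_digraph) n.
            graph G \<and> verts G = {..<n} \<and>
            graph G' \<and> spanning G' G \<and> degree_conditions G' \<longrightarrow>
            (\<exists>y t. runs P (CONS (enc_graph n G) (enc_graph n G')) y t \<and>
                   lists_family y {S. minimal_cds G S} \<and>
                   real t \<le> 2 powr (real n * (1 - 1 / 10 ^ 26)) * real n ^ k))"
proof (intro conjI)
  have count: "real (card {S. minimal_cds G S}) \<le> 1 * 2 powr (real n * (1 - 1 / 10 ^ 26))"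
    if h: "graph G \<and> card (verts G) = n \<and> graph G' \<and> spanning G' G \<and> degree_conditions G'"
    for G G' :: "('a, 'b) pre_digraph" and n
  proof -
    interpret graph G using h by simp
    have V: "verts G' = verts G" using h by (simp add: spanning_def)
    \<comment> \<open>The minimal sets of \<open>G\<close> lie in the family defined from
      \<open>G'\<close>, whose size bound gives the constant 1.\<close>
    have "{S. minimal_cds G S} \<subseteq> small_family (verts G) (dominates G')"
      using h minimal_connected_in_small_family by (auto simp: minimal_cds_iff)
    then have "card {S. minimal_cds G S} \<le> card (small_family (verts G) (dominates G'))"
      by (intro card_mono) (simp_all add: small_family_def)
    then have "real (card {S. minimal_cds G S}) \<le> real (card (small_family (verts G) (dominates G')))"
      by (simp only: of_nat_le_iff)
    also have "\<dots> \<le> 2 powr (real n * (1 - 1 / 10 ^ 26))"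
      using card_small_family_graph_le[of G'] h V by simp
    finally show ?thesis by simp
  qed
  show "\<exists>C :: real. \<forall>(G :: ('a, 'b) pre_digraph) (G' :: ('a, 'b) pre_digraph) n.
            graph G \<and> card (verts G) = n \<and>
            graph G' \<and> spanning G' G \<and> degree_conditions G' \<longrightarrow>
            real (card {S. minimal_cds G S}) \<le> C * 2 powr (real n * (1 - 1 / 10 ^ 26))"
    by (intro exI[of _ 1] allI impI) (rule count)
next
  have run: "\<exists>y t. runs prog (CONS (enc_graph n G) (enc_graph n G')) y t \<and>
                   lists_family y {S. minimal_cds G S} \<and>
                   real t \<le> 2 powr (real n * (1 - 1 / 10 ^ 26)) * real n ^ 10"
    if h: "graph G \<and> verts G = {..<n} \<and> graph G' \<and> spanning G' G \<and> degree_conditions G'"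
    for G G' :: "(nat, nat \<times> nat) pre_digraph" and n
  proof -
    have V: "verts G' = {..<n}" using h unfolding spanning_def by metis
    have n: "n \<ge> 14" using degree_conditions_card_ge[of G'] h V by simp
    obtain xs where xs: "enc_graph n G = enc_rows xs" "matrix n (dominates G) xs" "\<forall>x\<in>set xs. len x \<le> n"
      using enc_graph_matrix[of G n] h by blast
    obtain ys where ys: "enc_graph n G' = enc_rows ys" "matrix n (dominates G') ys" "\<forall>y\<in>set ys. len y \<le> n"
      using enc_graph_matrix[of G' n] h by blast
    have "S \<in> small_family {..<n} (dominates G')" if "minimal_connected {..<n} (dominates G) S" for S
      using minimal_connected_in_small_family[of G G' S] h that by simp
    then obtain y t where y: "runs prog (CONS (enc_graph n G) (enc_graph n G')) y t"
      "lists_family y {S. minimal_connected {..<n} (dominates G) S}"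
      and t: "t \<le> (1 + 2 * n * card (small_family {..<n} (dominates G'))) * (2000 * (n + 1) ^ 4) + 20"
      using runs_prog[OF xs(2,3) ys(2,3)] n xs(1) ys(1) by auto
    have "real (card (small_family {..<n} (dominates G'))) \<le> 2 powr (real n * (1 - 1 / 10 ^ 26))"
      using card_small_family_graph_le[of G'] h V by simp
    moreover have "(1::real) \<le> 2 powr (real n * (1 - 1 / 10 ^ 26))"
      by (intro ge_one_powr_ge_zero) auto
    ultimately have "real t \<le> 2 powr (real n * (1 - 1 / 10 ^ 26)) * real n ^ 10"
      using running_time_arith n t by blast
    moreover have "{S. minimal_cds G S} = {S. minimal_connected {..<n} (dominates G) S}"
      using minimal_cds_iff[of G] h by simp
    ultimately show ?thesis using y by auto
  qed
  show "\<exists>(P :: program) (k :: nat).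
            \<forall>(G :: (nat, nat \<times> nat) pre_digraph) (G' :: (nat, nat \<times> nat) pre_digraph) n.
            graph G \<and> verts G = {..<n} \<and>
            graph G' \<and> spanning G' G \<and> degree_conditions G' \<longrightarrow>
            (\<exists>y t. runs P (CONS (enc_graph n G) (enc_graph n G')) y t \<and>
                   lists_family y {S. minimal_cds G S} \<and>
                   real t \<le> 2 powr (real n * (1 - 1 / 10 ^ 26)) * real n ^ k)"
    \<comment> \<open>Of the exponent 10, the factor 2n and the node cost of order n^4 take 5; the
      absorbed constant takes the other 5.\<close>
    by (intro exI[of _ prog] exI[of _ 10] allI impI) (rule run)
qed

end
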